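(* Let $x_0\in L^2(\Omega,\mathcal F,\mathbb P;H)$ and let $(x_n)_{n\in\mathbb N}$ be generated as follows. For every $n\in\mathbb N$, set $\mathcal X_n=\sigma(x_0,\dots,x_n)$, take $\lambda_n\in L^\infty(\Omega,\mathcal F,\mathbb P;\,]0,+\infty[)$, $d_n\in L^2(\Omega,\mathcal F,\mathbb P;H)$, and $\delta_n\in\mathfrak C(\Omega,\mathcal F,\mathbb P;H)$ such that $$\mathsf E\big(\lambda_n(2-\lambda_n)\|d_n\|^2\,\big|\,\mathcal X_n\big)\ge 0\ \text{ a.s.}$$ and $$(\forall \mathsf z\in Z)\quad \mathsf E\big(\lambda_n\langle \mathsf z+d_n-x_n, d_n\rangle\,\big|\,\mathcal X_n\big)\le \delta_n(\cdot,\mathsf z)/2\ \text{ a.s.},$$ and set $x_{n+1}=x_n-\lambda_n d_n$. Then the following hold: (i) $(x_n)_{n\in\mathbb N}$ is a well-defined sequence in $L^2(\Omega,\mathcal F,\mathbb P;H)$. (ii) Let $n\in\mathbb N$ and $\mathsf z\in Z$. Then $\mathsf E(\|x_{n+1}-\mathsf z\|^2|\mathcal X_n)\le\|x_n-\mathsf z\|^2-\mathsf E(\lambda_n(2-\lambda_n)\|d_n\|^2|\mathcal X_n)+\delta_n(\cdot,\mathsf z)$ a.s. (iii) Let $n\in\mathbb N$ and $z\in L^2(\Omega,\mathcal X_n,\mathbb P;Z)$. Then $\mathsf E(\|x_{n+1}-z\|^2|\mathcal X_n)\le\|x_n-z\|^2-\mathsf E(\lambda_n(2-\lambda_n)\|d_n\|^2|\mathcal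 X_n)+\delta_n(\cdot,z)$ a.s. (iv) Let $n\in\mathbb N$ and $z\in L^2(\Omega,\mathcal X_n,\mathbb P;Z)$. Then $\|x_{n+1}-z\|_{L^2(\Omega,\mathcal F,\mathbb P;H)}^2\le\|x_n-z\|_{L^2(\Omega,\mathcal F,\mathbb P;H)}^2-\mathsf E(\lambda_n(2-\lambda_n)\|d_n\|^2)+\mathsf E\,\delta_n(\cdot,z)$. (v) Suppose that, for every $\mathsf z\in Z$, $\sum_{n\in\mathbb N}\delta_n(\cdot,\mathsf z)<+\infty$ a.s. Then: (a) $(\|x_n\|)_{n\in\mathbb N}$ is bounded a.s. (b) For every $Z$-valued random variable $z$, $(\|x_n-z\|)_{n\in\mathbb N}$ converges a.s. (c) $\sum_{n\in\mathbb N}\mathsf E(\lambda_n(2-\lambda_n)\|d_n\|^2|\mathcal X_n)<+\infty$ a.s. (d) If $\mathfrak W(x_n)_{n\in\mathbb N}\subset Z$ a.s., then $(x_n)_{n\in\mathbb N}$ converges weakly a.s. to a $Z$-valued random variable. (e) If $\mathfrak S(x_n)_{n\in\mathbb N}\cap Z\neq\varnothing$ a.s., then $(x_n)_{n\in\mathbb N}$ converges strongly a.s. to a $Z$-valued random variable. (f) If $\mathfrak S(x_n)_{n\in\mathbb N}\neq\varnothing$ a.s. and $\mathfrak W(x_n)_{n\in\mathbb N}\subset Z$ a.s., then $(x_n)_{n\in\mathbb N}$ converges strongly a.s. to a $Z$-valued random variable. (vi) Suppose that, for every $\mathsf z\in Z$, $\sum_{n\in\mathbb N}\mathsf E\,\delta_n(\cdot,\mathsf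 z)<+\infty$. Then: (a) $(\|x_n\|_{L^2(\Omega,\mathcal F,\mathbb P;H)})_{n\in\mathbb N}$ is bounded. (b) For every $z\in L^2(\Omega,\mathcal F,\mathbb P;Z)$, $(\|x_n-z\|_{L^1(\Omega,\mathcal F,\mathbb P;H)})_{n\in\mathbb N}$ converges. (c) $\sum_{n\in\mathbb N}\mathsf E(\lambda_n(2-\lambda_n)\|d_n\|^2)<+\infty$. (d) Suppose that $(x_n)_{n\in\mathbb N}$ converges weakly a.s. to an $H$-valued random variable $x$. Then $x\in L^2(\Omega,\mathcal F,\mathbb P;H)$ and $(x_n)_{n\in\mathbb N}$ converges weakly in $L^2(\Omega,\mathcal F,\mathbb P;H)$ to $x$. (e) Let $x$ be a $Z$-valued random variable. Then $(x_n)_{n\in\mathbb N}$ converges strongly a.s. to $x$ if and only if $(x_n)_{n\in\mathbb N}$ converges strongly in $L^1(\Omega,\mathcal F,\mathbb P;H)$ to $x$. In this case, $x\in L^2(\Omega,\mathcal F,\mathbb P;Z)$ and $(x_n)_{n\in\mathbb N}$ converges weakly in $L^2(\Omega,\mathcal F,\mathbb P;H)$ to $x$.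
   Context: $H$ is a separable real Hilbert space with scalar product $\langle\cdot,\cdot\rangle$, norm $\|\cdot\|$ and Borel $\sigma$-algebra $\mathcal B_H$; $(\Omega,\mathcal F,\mathbb P)$ is a complete probability space with expectation $\mathsf E$; "a.s." means $\mathbb P$-almost surely. $Z$ is a nonempty closed subset of $H$. An $H$-valued random variable is a measurable map $(\Omega,\mathcal F)\to(H,\mathcal B_H)$. For a sub $\sigma$-algebra $\mathcal X$ of $\mathcal F$ and $p\in[1,+\infty[$, $L^p(\Omega,\mathcal X,\mathbb P;H)$ is the space of (classes of a.s. equal) $\mathcal X$-measurable $x\colon\Omega\to H$ with $\mathsf E\|x\|^p<+\infty$, with norm $(\mathsf E\|x\|^p)^{1/p}$; $L^2$ has scalar product $(x,y)\mapsto\mathsf E\langle x,y\rangle$. For $S\in\mathcal B_H$, $L^p(\Omega,\mathcal X,\mathbb P;S)$ is the set of $x\in L^p(\Omega,\mathcal X,\mathbb P;H)$ with $x\in S$ a.s. For $S\subset\mathbb R$, $L^\infty(\Omega,\mathcal X,\mathbb P;S)$ is the set of essentially bounded $\mathcal X$-measurable real random variables with values in $S$ a.s. $\mathsf E(\cdot|\mathcal X)$ is conditional expectation and $\sigma(\cdot)$ the generated $\sigma$-algebra. $\mathfrak C(\Omega,\mathcal F,\mathbb P;H)$ is the class of functions $\varphi\colon\Omega\times H\to[0,+\infty[$ such that $\varphi(\omega,\cdot)$ is continuous for $\mathbb P$-almost every $\omega$, $\varphi(\cdot,\mathsf x)$ is $\mathcal F$-measurable for every $\mathsf x\in H$, and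 $\int_\Omega\varphi(\omega,x(\omega))\,\mathbb P(d\omega)<+\infty$ for every $x\in L^2(\Omega,\mathcal F,\mathbb P;H)$. Given a random variable $x$, $\varphi(\cdot,x)$ denotes $\omega\mapsto\varphi(\omega,x(\omega))$. $\mathfrak W(\mathsf x_n)_{n}$ and $\mathfrak S(\mathsf x_n)_{n}$ are the sets of weak, respectively strong, sequential cluster points of a sequence $(\mathsf x_n)$ in $H$; statements such as "$\mathfrak W(x_n)_{n}\subset Z$ a.s." mean that $\mathfrak W(x_n(\omega))_n\subset Z$ for $\mathbb P$-almost every $\omega$. Weak (strong) convergence a.s. means weak (strong) convergence in $H$ of $(x_n(\omega))_n$ for $\mathbb P$-almost every $\omega$. *)

theory Defs
  imports "HOL-Probability.Probability"
begin

text \<open>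
  Elements of Lebesgue spaces are represented by functions, with equality almost everywhere in
  place of equality of classes. In \<open>Lp_space M X p S\<close> the probability is carried by
  \<open>M\<close>; only the \<open>\<sigma>\<close>-algebra of \<open>X\<close> matters.
\<close>

definition Lp_space ::
  "'w measure \<Rightarrow> 'w measure \<Rightarrow> real \<Rightarrow> 'h set \<Rightarrow> ('w \<Rightarrow> 'h :: real_normed_vector) set" where
  "Lp_space M X p S =
     {x \<in> borel_measurable X. integrable M (\<lambda>\<omega>. norm (x \<omega>) powr p) \<and> (AE \<omega> in M. x \<omega> \<in> S)}"

definition Lp_norm :: "'w measure \<Rightarrow> real \<Rightarrow> ('w \<Rightarrow> 'h :: real_normed_vector) \<Rightarrow> real" where
  "Lp_norm M p x = (\<integral>\<omega>. norm (x \<omega>) powr p \<partial>M) powr (1 / p)"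

definition Linf_space :: "'w measure \<Rightarrow> 'w measure \<Rightarrow> real set \<Rightarrow> ('w \<Rightarrow> real) set" where
  "Linf_space M X S =
     {f \<in> borel_measurable X. (\<exists>C. AE \<omega> in M. \<bar>f \<omega>\<bar> \<le> C) \<and> (AE \<omega> in M. f \<omega> \<in> S)}"

definition integrand_class :: "'w measure \<Rightarrow> ('w \<Rightarrow> 'h :: real_normed_vector \<Rightarrow> real) set" where
  "integrand_class M = {\<phi>.
     (\<forall>\<omega>\<in>space M. \<forall>x. 0 \<le> \<phi> \<omega> x) \<and>
     (AE \<omega> in M. continuous_on UNIV (\<phi> \<omega>)) \<and>
     (\<forall>x. (\<lambda>\<omega>. \<phi> \<omega> x) \<in> borel_measurable M) \<and>
     (\<forall>x\<in>Lp_space M M 2 UNIV. (\<integral>\<^sup>+\<omega>. ennreal (\<phi> \<omega> (x \<omega>)) \<partial>M) < \<infinity>)}"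

text \<open>The \<open>\<sigma>\<close>-algebra generated by \<open>x 0, \<dots>, x n\<close>.\<close>

definition generated_algebra ::
  "'w measure \<Rightarrow> (nat \<Rightarrow> 'w \<Rightarrow> 'h :: topological_space) \<Rightarrow> nat \<Rightarrow> 'w measure" where
  "generated_algebra M x n =
     sigma (space M) {x k -` A \<inter> space M | k A. k \<le> n \<and> A \<in> sets borel}"

definition weakly_converges :: "(nat \<Rightarrow> 'h :: real_inner) \<Rightarrow> 'h \<Rightarrow> bool" where
  "weakly_converges X l \<longleftrightarrow> (\<forall>u. (\<lambda>n. X n \<bullet> u) \<longlonglongrightarrow> l \<bullet> u)"

definition weak_cluster_points :: "(nat \<Rightarrow> 'h :: real_inner) \<Rightarrow> 'h set" where
  "weak_cluster_points X = {l. \<exists>r :: nat \<Rightarrow> nat. strict_mono r \<and> weakly_converges (X \<circ> r) l}"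

definition strong_cluster_points :: "(nat \<Rightarrow> 'h :: topological_space) \<Rightarrow> 'h set" where
  "strong_cluster_points X = {l. \<exists>r :: nat \<Rightarrow> nat. strict_mono r \<and> (X \<circ> r) \<longlonglongrightarrow> l}"

text \<open>
  Convergence in a Lebesgue space includes membership of the sequence and of the limit: the
  Bochner integral of a non-integrable function is \<open>0\<close>, so that the limits alone would
  say nothing about functions outside the space.
\<close>

definition Lp_converges ::
  "'w measure \<Rightarrow> real \<Rightarrow> (nat \<Rightarrow> 'w \<Rightarrow> 'h :: real_normed_vector) \<Rightarrow> ('w \<Rightarrow> 'h) \<Rightarrow> bool" where
  "Lp_converges M p X x \<longleftrightarrow>
     (\<forall>n. X n \<in> Lp_space M M p UNIV) \<and> x \<in> Lp_space M M p UNIV \<and>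
     (\<lambda>n. Lp_norm M p (\<lambda>\<omega>. X n \<omega> - x \<omega>)) \<longlonglongrightarrow> 0"

definition weakly_converges_L2 ::
  "'w measure \<Rightarrow> (nat \<Rightarrow> 'w \<Rightarrow> 'h :: real_inner) \<Rightarrow> ('w \<Rightarrow> 'h) \<Rightarrow> bool" where
  "weakly_converges_L2 M X x \<longleftrightarrow>
     (\<forall>n. X n \<in> Lp_space M M 2 UNIV) \<and> x \<in> Lp_space M M 2 UNIV \<and>
     (\<forall>y\<in>Lp_space M M 2 UNIV.
        (\<lambda>n. \<integral>\<omega>. X n \<omega> \<bullet> y \<omega> \<partial>M) \<longlonglongrightarrow> (\<integral>\<omega>. x \<omega> \<bullet> y \<omega> \<partial>M))"

end

theory Submission
  imports Defs "HOL-Complex_Analysis.Great_Picard"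
begin

text \<open>
  For a fixed point \<open>z\<close> of \<open>Z\<close>, expanding \<open>\<parallel>x (Suc n) - z\<parallel>\<^sup>2\<close> with
  \<open>x (Suc n) = x n - lam n *\<^sub>R d n\<close> and conditioning turns the assumption on the half-spaces into
  \<open>E(\<parallel>x (Suc n) - z\<parallel>\<^sup>2 | \<X> n) \<le> \<parallel>x n - z\<parallel>\<^sup>2 - E(lam n (2 - lam n) \<parallel>d n\<parallel>\<^sup>2 | \<X> n) + \<delta> n z\<close>.
  Here \<open>\<X> n\<close> is the \<open>\<sigma>\<close>-algebra generated by \<open>x 0, \<dots>, x n\<close>. Three ideas lead from here to the theorem.

  From fixed to random points. The conditional expectation to be bounded is affine in \<open>z\<close> and the
  bound is continuous in \<open>z\<close>. A random point is approximated uniformly by measurable points with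
  countably many values in \<open>Z\<close>. Where such an approximant equals a constant, its conditional
  expectation is that of the constant, and an approximation within \<open>1/k\<close> costs at most
  \<open>1/k\<close> times one fixed conditional expectation
  (\<open>real_cond_exp_affine_le_random_point\<close>).

  Almost sure convergence. The inequality says that \<open>\<parallel>x n - z\<parallel>\<^sup>2\<close> is a nonnegative
  supermartingale up to a summable error, so that it converges and the decrease is summable
  (\<open>Robbins_Siegmund\<close>). The error \<open>\<delta> n z\<close> need not be adapted; but the excess of the conditional
  expectation over \<open>\<parallel>x n - z\<parallel>\<^sup>2\<close> minus the decrease is adapted and lies below \<open>\<delta> n z\<close>
  (\<open>Robbins_Siegmund_dominated\<close>). Supermartingales converge because they cannot cross an interval
  upwards infinitely often (\<open>nonneg_supermartingale_convergent\<close>). A countable dense subset of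
  \<open>Z\<close> provides one null set outside which \<open>\<parallel>x n - z\<parallel>\<close> converges for all \<open>z\<close> in \<open>Z\<close>
  (\<open>Fejer_all_points\<close>); from there the argument is deterministic, path by path: a bounded sequence
  whose distances to all its weak cluster points converge has only one of them (\<open>Opial\<close>).
  The limit is measurable because its inner products with fixed vectors are
  (\<open>measurable_weak_limit\<close>).

  Convergence in mean. Taking expectations and telescoping bounds \<open>x n\<close> in \<open>L\<^sup>2\<close>. This makes
  the sequence uniformly integrable, even after taking inner products with a fixed element of
  \<open>L\<^sup>2\<close>, so that almost sure limits pass to expectations
  (\<open>integral_dominated_by_L2_products\<close>).
\<close>

section \<open>Weak convergence in separable Hilbert spaces\<close>

lemma weakly_converges_unique:
  assumes "weakly_converges X l" "weakly_converges X m"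
  shows "l = m"
proof -
  have "l \<bullet> u = m \<bullet> u" for u
    using assms unfolding weakly_converges_def by (metis LIMSEQ_unique)
  then show ?thesis by (metis vector_eq_rdot)
qed

lemma tendsto_imp_weakly_converges:
  assumes "X \<longlonglongrightarrow> l"
  shows "weakly_converges X l"
  using assms by (auto simp: weakly_converges_def intro!: tendsto_intros)

text \<open>
  The parallelogram law: if the norms of \<open>p n\<close> and \<open>p m\<close> are almost minimal over a convex set,
  then their midpoint, which cannot be shorter, forces \<open>p n - p m\<close> to be short. Here \<open>c n\<close> plays
  the role of the squared distance from the origin to the \<open>n\<close>-th of a decreasing sequence of
  convex sets.
\<close>
lemma norm_midpoint_Cauchy:
  fixes p :: "nat \<Rightarrow> 'h :: {real_inner, banach}"
  assumes c: "convergent c" and e: "e \<longlonglongrightarrow> 0"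
    and upper: "\<And>n. (norm (p n))\<^sup>2 \<le> c n + e n"
    and lower: "\<And>m n. n \<le> m \<Longrightarrow> c n \<le> (norm ((1 / 2) *\<^sub>R (p n + p m)))\<^sup>2"
  shows "Cauchy p"
proof -
  obtain L where L: "c \<longlonglongrightarrow> L" using c by (auto simp: convergent_def)
  have lim: "(\<lambda>n. c n) \<longlonglongrightarrow> L" "(\<lambda>n. c n + e n) \<longlonglongrightarrow> L"
    using L tendsto_add[OF L e] by simp_all
  have key: "(norm (p n - p m))\<^sup>2 \<le> 2 * (c n + e n) + 2 * (c m + e m) - 4 * c n" if "n \<le> m" for n m
  proof -
    have "(norm (p n - p m))\<^sup>2 = 2 * (norm (p n))\<^sup>2 + 2 * (norm (p m))\<^sup>2 - 4 * (norm ((1 / 2) *\<^sub>R (p n + p m)))\<^sup>2"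
      by (simp add: power2_norm_eq_inner inner_simps inner_commute algebra_simps)
    moreover have "A \<le> 2 * B' + 2 * C' - 4 * D'"
      if "A = 2 * B + 2 * C - 4 * D" "B \<le> B'" "C \<le> C'" "D' \<le> D" for A B B' C C' D D' :: real
      using that by linarith
    ultimately show ?thesis using upper lower[OF \<open>n \<le> m\<close>] by blast
  qed
  show ?thesis
  proof (rule CauchyI')
    fix s :: real assume s: "0 < s"
    define t where "t = s\<^sup>2 / 8"
    have t: "t > 0" using s by (simp add: t_def)
    obtain N1 where N1: "\<And>n. n \<ge> N1 \<Longrightarrow> \<bar>c n - L\<bar> < t"
      using LIMSEQ_D[OF lim(1) t] by auto
    obtain N2 where N2: "\<And>n. n \<ge> N2 \<Longrightarrow> \<bar>c n + e n - L\<bar> < t"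
      using LIMSEQ_D[OF lim(2) t] by auto
    show "\<exists>M. \<forall>m\<ge>M. \<forall>n>m. dist (p m) (p n) < s"
    proof (rule exI[of _ "max N1 N2"], intro allI impI)
      fix m n assume mn: "max N1 N2 \<le> m" "m < n"
      have "(norm (p m - p n))\<^sup>2 \<le> 2 * (c m + e m) + 2 * (c n + e n) - 4 * c m"
        using key mn by simp
      also have "\<dots> < 8 * t" using N1[of m] N2[of m] N2[of n] mn by (simp add: abs_less_iff)
      also have "\<dots> = s\<^sup>2" by (simp add: t_def)
      finally show "dist (p m) (p n) < s" using s by (simp add: dist_norm power2_less_imp_less)
    qed
  qed
qed

text \<open>
  The vector that represents the limit functional is built from the sequence itself. The convex
  hulls of the tails of \<open>X\<close> decrease, and almost shortest vectors \<open>p n\<close> of these hulls form a Cauchy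
  sequence. For every \<open>u\<close>, the numbers \<open>p n \<bullet> u\<close> are averages of late values of \<open>X k \<bullet> u\<close>, so
  that the strong limit of \<open>p\<close> is the weak limit of \<open>X\<close>.
\<close>
lemma weakly_Cauchy_imp_weakly_converges:
  fixes X :: "nat \<Rightarrow> 'h :: {real_inner, banach}"
  assumes bd: "\<And>n. norm (X n) \<le> C" and conv: "\<And>u. convergent (\<lambda>n. X n \<bullet> u)"
  shows "\<exists>l. weakly_converges X l"
proof -
  define K where "K n = convex hull (X ` {n..})" for n
  define c where "c n = (INF q\<in>K n. (norm q)\<^sup>2)" for n
  have K_ne: "K n \<noteq> {}" for n by (auto simp: K_def)
  have K_mono: "K m \<subseteq> K n" if "n \<le> m" for n m
    unfolding K_def by (rule hull_mono) (use that in auto)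
  have K_bd: "norm q \<le> C" if "q \<in> K n" for q n
  proof -
    have "K n \<subseteq> cball 0 C" unfolding K_def by (rule hull_minimal) (auto simp: bd)
    then show ?thesis using that by auto
  qed
  have bdd: "bdd_below ((\<lambda>q. (norm q)\<^sup>2) ` K n)" for n by (rule bdd_belowI[of _ 0]) auto
  have c_le: "c n \<le> (norm q)\<^sup>2" if "q \<in> K n" for q n
    unfolding c_def by (rule cINF_lower[OF bdd that])
  have c_bd: "c n \<le> C\<^sup>2" for n
  proof -
    obtain q where q: "q \<in> K n" using K_ne by blast
    then show ?thesis using c_le[OF q] K_bd[OF q] power_mono[of "norm q" C 2] by simp
  qed
  have "incseq c" unfolding incseq_def c_def
    by (auto intro!: cINF_superset_mono K_ne bdd K_mono)
  then obtain L where "c \<longlonglongrightarrow> L" using incseq_convergent[of c "C\<^sup>2"] c_bd by metis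
  then have c_conv: "convergent c" by (rule convergentI)
  have "\<exists>q\<in>K n. (norm q)\<^sup>2 \<le> c n + inverse (real (Suc n))" for n
  proof -
    have "c n < c n + inverse (real (Suc n))" by simp
    then have "\<exists>q\<in>K n. (norm q)\<^sup>2 < c n + inverse (real (Suc n))"
      by (subst (asm) (1) c_def, subst (asm) cINF_less_iff[OF K_ne bdd])
    then show ?thesis by (auto intro: less_imp_le)
  qed
  then obtain p where p: "\<And>n. p n \<in> K n" "\<And>n. (norm (p n))\<^sup>2 \<le> c n + inverse (real (Suc n))"
    by metis
  have "Cauchy p"
  proof (rule norm_midpoint_Cauchy[OF c_conv LIMSEQ_inverse_real_of_nat p(2)])
    fix m n :: nat assume "n \<le> m"
    then have "(1 / 2) *\<^sub>R p n + (1 / 2) *\<^sub>R p m \<in> K n"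
      using p(1)[of n] p(1)[of m] K_mono unfolding K_def
      by (intro convexD[OF convex_convex_hull]) auto
    then show "c n \<le> (norm ((1 / 2) *\<^sub>R (p n + p m)))\<^sup>2" by (metis c_le scaleR_right_distrib)
  qed
  then obtain l where l: "p \<longlonglongrightarrow> l" using Cauchy_convergent convergent_def by blast
  have "(\<lambda>n. X n \<bullet> u) \<longlonglongrightarrow> l \<bullet> u" for u
  proof -
    obtain s where s: "(\<lambda>n. X n \<bullet> u) \<longlonglongrightarrow> s" using conv convergent_def by blast
    have "(\<lambda>n. p n \<bullet> u) \<longlonglongrightarrow> s"
    proof (rule LIMSEQ_I)
      fix r :: real assume "0 < r"
      then have "0 < r / 2" by simp
      from LIMSEQ_D[OF s this] obtain N where N: "\<And>n. n \<ge> N \<Longrightarrow> \<bar>X n \<bullet> u - s\<bar> < r / 2"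
        by auto
      have "\<bar>p n \<bullet> u - s\<bar> < r" if "n \<ge> N" for n
      proof -
        have "K n \<subseteq> {q. u \<bullet> q \<le> s + r / 2} \<inter> {q. u \<bullet> q \<ge> s - r / 2}"
          unfolding K_def
        proof (rule hull_minimal)
          show "X ` {n..} \<subseteq> {q. u \<bullet> q \<le> s + r / 2} \<inter> {q. u \<bullet> q \<ge> s - r / 2}"
          proof
            fix q assume "q \<in> X ` {n..}"
            then obtain k where k: "k \<ge> N" "q = X k" using \<open>n \<ge> N\<close> by (auto dest: order_trans)
            then show "q \<in> {q. u \<bullet> q \<le> s + r / 2} \<inter> {q. u \<bullet> q \<ge> s - r / 2}"
              using N[OF k(1)] unfolding abs_less_iff by (simp add: inner_commute)
          qed
        qed (intro convex_Int convex_halfspace_le convex_halfspace_ge)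
        then have "u \<bullet> p n \<le> s + r / 2" "u \<bullet> p n \<ge> s - r / 2" using p(1)[of n] by auto
        then show ?thesis using \<open>0 < r\<close> by (simp add: inner_commute abs_less_iff)
      qed
      then show "\<exists>N. \<forall>n\<ge>N. norm (p n \<bullet> u - s) < r" by auto
    qed
    moreover have "(\<lambda>n. p n \<bullet> u) \<longlonglongrightarrow> l \<bullet> u" by (intro tendsto_intros l)
    ultimately show ?thesis using s LIMSEQ_unique by blast
  qed
  then show ?thesis by (auto simp: weakly_converges_def)
qed

lemma convergent_of_uniformly_approximable:
  fixes f :: "nat \<Rightarrow> real"
  assumes "\<And>e. e > 0 \<Longrightarrow> \<exists>g. convergent g \<and> (\<forall>n. \<bar>f n - g n\<bar> \<le> e)"
  shows "convergent f"
proof -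
  have "Cauchy f"
  proof (rule CauchyI)
    fix e :: real assume e: "e > 0"
    then obtain g where g: "convergent g" "\<And>n. \<bar>f n - g n\<bar> \<le> e / 4" using assms[of "e/4"] by auto
    then have "Cauchy g" by (simp add: convergent_Cauchy)
    then obtain N where N: "\<And>m n. m \<ge> N \<Longrightarrow> n \<ge> N \<Longrightarrow> norm (g m - g n) < e / 2"
      using e CauchyD[of g "e/2"] by auto
    have "norm (f m - f n) < e" if "m \<ge> N" "n \<ge> N" for m n
      using N[OF that] g(2)[of m] g(2)[of n] e by (auto simp: abs_if split: if_splits)
    then show "\<exists>M. \<forall>m\<ge>M. \<forall>n\<ge>M. norm (f m - f n) < e" by blast
  qed
  then show ?thesis by (simp add: Cauchy_convergent)
qed

text \<open>
  A diagonal argument makes the inner products with a countable dense set of vectors converge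
  along one subsequence; boundedness extends this to all vectors.
\<close>
lemma bounded_imp_weak_cluster_point:
  fixes X :: "nat \<Rightarrow> 'h :: {real_inner, banach, second_countable_topology}"
  assumes bd: "\<And>n. norm (X n) \<le> C"
  shows "weak_cluster_points X \<noteq> {}"
proof -
  obtain D :: "'h set" where D: "countable D" "UNIV \<subseteq> closure D"
    using separable[of "UNIV :: 'h set"] by metis
  have C: "C \<ge> 0" using bd[of 0] norm_ge_zero order_trans by blast
  obtain k where k: "strict_mono (k :: nat \<Rightarrow> nat)"
    \<comment> \<open>Division by \<open>1 + norm u\<close> makes the bound uniform in \<open>u\<close>, as the diagonal lemma requires.\<close>
    and k': "\<And>u. u \<in> D \<Longrightarrow> \<exists>l. (\<lambda>n. (X (k n) \<bullet> u) / (1 + norm u)) \<longlonglongrightarrow> l"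
  proof (rule function_convergent_subsequence[OF D(1), of "\<lambda>n u. (X n \<bullet> u) / (1 + norm u)" C])
    fix n u
    have "\<bar>X n \<bullet> u\<bar> \<le> norm (X n) * norm u" by (rule Cauchy_Schwarz_ineq2)
    also have "\<dots> \<le> C * (1 + norm u)" using bd[of n] C by (intro mult_mono) auto
    finally show "norm (X n \<bullet> u / (1 + norm u)) \<le> C"
      by (simp add: divide_le_eq add_pos_nonneg)
  qed auto
  have conv: "convergent (\<lambda>n. X (k n) \<bullet> u)" if u: "u \<in> D" for u
  proof -
    obtain l where "(\<lambda>n. (X (k n) \<bullet> u) / (1 + norm u)) \<longlonglongrightarrow> l" using k'[OF u] by blast
    then have "(\<lambda>n. (X (k n) \<bullet> u) / (1 + norm u) * (1 + norm u)) \<longlonglongrightarrow> l * (1 + norm u)"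
      by (intro tendsto_intros)
    moreover have "1 + norm u \<noteq> 0" by (metis add_pos_nonneg less_irrefl norm_ge_zero zero_less_one)
    ultimately show ?thesis by (auto simp: convergent_def)
  qed
  have "convergent (\<lambda>n. X (k n) \<bullet> u)" for u
  proof (rule convergent_of_uniformly_approximable)
    fix e :: real assume e: "e > 0"
    have "u \<in> closure D" using D by auto
    moreover have "0 < e / (1 + C)" using e C by simp
    ultimately obtain v where v: "v \<in> D" "dist v u < e / (1 + C)"
      unfolding closure_approachable by blast
    have "\<bar>X (k n) \<bullet> u - X (k n) \<bullet> v\<bar> \<le> e" for n
    proof -
      have "\<bar>X (k n) \<bullet> u - X (k n) \<bullet> v\<bar> = \<bar>X (k n) \<bullet> (u - v)\<bar>" by (simp add: inner_diff_right)
      also have "\<dots> \<le> norm (X (k n)) * norm (u - v)" by (rule Cauchy_Schwarz_ineq2)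
      also have "\<dots> \<le> (1 + C) * (e / (1 + C))"
        using bd[of "k n"] v(2) C by (intro mult_mono) (auto simp: dist_norm norm_minus_commute)
      also have "\<dots> = e" using C by simp
      finally show ?thesis .
    qed
    then show "\<exists>g. convergent g \<and> (\<forall>n. \<bar>X (k n) \<bullet> u - g n\<bar> \<le> e)" using conv[OF v(1)] by blast
  qed
  then obtain l where "weakly_converges (\<lambda>n. X (k n)) l"
    using weakly_Cauchy_imp_weakly_converges[of "\<lambda>n. X (k n)" C] bd by auto
  then show ?thesis using k by (auto simp: weak_cluster_points_def comp_def)
qed

text \<open>
  Otherwise some subsequence stays away from \<open>l\<close> in some direction, and it has a weak cluster
  point of its own.
\<close>
lemma weakly_converges_of_unique_cluster_point:
  fixes X :: "nat \<Rightarrow> 'h :: {real_inner, banach, second_countable_topology}"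
  assumes bd: "\<And>n. norm (X n) \<le> C" and uniq: "weak_cluster_points X \<subseteq> {l}"
  shows "weakly_converges X l"
  unfolding weakly_converges_def
proof
  fix u
  show "(\<lambda>n. X n \<bullet> u) \<longlonglongrightarrow> l \<bullet> u"
  proof (rule ccontr)
    assume "\<not> ?thesis"
    then obtain e where e: "e > 0" "\<And>N. \<exists>n\<ge>N. \<not> dist (X n \<bullet> u) (l \<bullet> u) < e"
      unfolding lim_sequentially by blast
    then have "infinite {n. \<not> dist (X n \<bullet> u) (l \<bullet> u) < e}"
      unfolding infinite_nat_iff_unbounded_le by blast
    then obtain r :: "nat \<Rightarrow> nat" where r: "strict_mono r" "\<And>n. \<not> dist (X (r n) \<bullet> u) (l \<bullet> u) < e"
      using infinite_enumerate by blast
    obtain m s where s: "strict_mono s" "weakly_converges ((X \<circ> r) \<circ> s) m"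
      using bounded_imp_weak_cluster_point[of "X \<circ> r" C] bd by (auto simp: weak_cluster_points_def)
    then have "m \<in> weak_cluster_points X"
      using strict_mono_o[OF r(1) s(1)] by (auto simp: weak_cluster_points_def comp_assoc)
    then have "m = l" using uniq by auto
    then have "(\<lambda>n. X (r (s n)) \<bullet> u) \<longlonglongrightarrow> l \<bullet> u"
      using s(2) by (simp add: weakly_converges_def)
    then show False using e(1) r(2) unfolding lim_sequentially by blast
  qed
qed

text \<open>
  If \<open>l\<close> and \<open>m\<close> are weak cluster points, then the convergence of \<open>\<parallel>X n - l\<parallel>\<close> and
  \<open>\<parallel>X n - m\<parallel>\<close> implies that of \<open>X n \<bullet> (l - m)\<close>. Its limit is both \<open>l \<bullet> (l - m)\<close> and
  \<open>m \<bullet> (l - m)\<close>, whence \<open>l = m\<close>.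
\<close>
lemma Opial:
  fixes X :: "nat \<Rightarrow> 'h :: {real_inner, banach, second_countable_topology}"
  assumes bd: "\<And>n. norm (X n) \<le> C"
    and conv: "\<And>z. z \<in> Z \<Longrightarrow> convergent (\<lambda>n. norm (X n - z))"
    and cl: "weak_cluster_points X \<subseteq> Z"
  shows "\<exists>l\<in>Z. weakly_converges X l"
proof -
  have uniq: "l = m" if lm: "l \<in> weak_cluster_points X" "m \<in> weak_cluster_points X" for l m
  proof -
    obtain a b where ab: "(\<lambda>n. norm (X n - l)) \<longlonglongrightarrow> a" "(\<lambda>n. norm (X n - m)) \<longlonglongrightarrow> b"
      using conv cl lm unfolding convergent_def by blast
    have eq: "X n \<bullet> (l - m) = ((norm (X n - m))\<^sup>2 - (norm (X n - l))\<^sup>2 + (norm l)\<^sup>2 - (norm m)\<^sup>2) / 2" for n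
      by (simp add: power2_norm_eq_inner inner_simps inner_commute)
    have lim: "(\<lambda>n. X n \<bullet> (l - m)) \<longlonglongrightarrow> (b\<^sup>2 - a\<^sup>2 + (norm l)\<^sup>2 - (norm m)\<^sup>2) / 2"
      unfolding eq by (intro tendsto_intros ab) simp
    have "q \<bullet> (l - m) = (b\<^sup>2 - a\<^sup>2 + (norm l)\<^sup>2 - (norm m)\<^sup>2) / 2" if q: "q \<in> weak_cluster_points X" for q
    proof -
      obtain r where "strict_mono r" "weakly_converges (X \<circ> r) q"
        using q by (auto simp: weak_cluster_points_def)
      then have "(\<lambda>n. X (r n) \<bullet> (l - m)) \<longlonglongrightarrow> q \<bullet> (l - m)" by (simp add: weakly_converges_def)
      moreover have "(\<lambda>n. X (r n) \<bullet> (l - m)) \<longlonglongrightarrow> (b\<^sup>2 - a\<^sup>2 + (norm l)\<^sup>2 - (norm m)\<^sup>2) / 2"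
        using LIMSEQ_subseq_LIMSEQ[OF lim \<open>strict_mono r\<close>] by (simp add: comp_def)
      ultimately show ?thesis by (rule LIMSEQ_unique)
    qed
    from this[OF lm(1)] this[OF lm(2)] have "(l - m) \<bullet> (l - m) = 0" by (simp add: inner_diff_left)
    then show ?thesis by simp
  qed
  obtain l where l: "l \<in> weak_cluster_points X" using bounded_imp_weak_cluster_point[of X C] bd by auto
  then have "weak_cluster_points X \<subseteq> {l}" using uniq by auto
  with weakly_converges_of_unique_cluster_point[of X C l] bd l cl show ?thesis by blast
qed

lemma strong_cluster_points_subset_weak:
  "strong_cluster_points X \<subseteq> weak_cluster_points (X :: nat \<Rightarrow> 'h :: real_inner)"
  by (auto simp: strong_cluster_points_def weak_cluster_points_def intro: tendsto_imp_weakly_converges)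

lemma tendsto_of_strong_cluster_point:
  fixes X :: "nat \<Rightarrow> 'h :: real_normed_vector"
  assumes "convergent (\<lambda>n. norm (X n - l))" "l \<in> strong_cluster_points X"
  shows "X \<longlonglongrightarrow> l"
proof -
  obtain r where r: "strict_mono r" "(X \<circ> r) \<longlonglongrightarrow> l"
    using assms(2) by (auto simp: strong_cluster_points_def)
  obtain a where a: "(\<lambda>n. norm (X n - l)) \<longlonglongrightarrow> a" using assms(1) convergent_def by blast
  have "(\<lambda>n. norm ((X \<circ> r) n - l)) \<longlonglongrightarrow> norm (l - l)" by (intro tendsto_intros r(2))
  moreover have "(\<lambda>n. norm ((X \<circ> r) n - l)) \<longlonglongrightarrow> a"
    using LIMSEQ_subseq_LIMSEQ[OF a r(1)] by (simp add: comp_def)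
  ultimately have "a = 0" using LIMSEQ_unique by fastforce
  then show ?thesis using a LIM_zero_iff tendsto_norm_zero_iff by blast
qed

text \<open>
  Weak lower semicontinuity of the norm.
\<close>
lemma norm_le_of_weakly_converges:
  assumes X: "weakly_converges X l" and freq: "\<exists>\<^sub>F n in sequentially. norm (X n) \<le> c"
  shows "norm l \<le> c"
proof (rule ccontr)
  assume "\<not> ?thesis"
  moreover have "0 \<le> c" using frequently_ex[OF freq] norm_ge_zero order_trans by blast
  ultimately have "c * norm l < norm l * norm l" by (intro mult_strict_right_mono) auto
  also have "\<dots> = l \<bullet> l" by (simp add: dot_square_norm power2_eq_square)
  finally have less: "c * norm l < l \<bullet> l" .
  have "(\<lambda>n. X n \<bullet> l) \<longlonglongrightarrow> l \<bullet> l" using X by (simp add: weakly_converges_def)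
  then have "\<forall>\<^sub>F n in sequentially. c * norm l < X n \<bullet> l" using less by (rule order_tendstoD)
  then have "\<forall>\<^sub>F n in sequentially. \<not> norm (X n) \<le> c"
  proof eventually_elim
    case (elim n)
    have "X n \<bullet> l \<le> norm (X n) * norm l" using Cauchy_Schwarz_ineq2[of "X n" l] by linarith
    then show ?case using elim mult_right_mono[of "norm (X n)" c "norm l"] by fastforce
  qed
  then show False using freq by (simp add: frequently_def)
qed

lemma convergent_norm_diff_dense:
  fixes X :: "nat \<Rightarrow> 'h :: real_normed_vector"
  assumes "\<And>v. v \<in> D \<Longrightarrow> convergent (\<lambda>n. norm (X n - v))" "z \<in> closure D"
  shows "convergent (\<lambda>n. norm (X n - z))"
proof (rule convergent_of_uniformly_approximable)
  fix e :: real assume "e > 0"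
  then obtain v where v: "v \<in> D" "dist v z < e" using assms(2) unfolding closure_approachable by blast
  have "\<bar>norm (X n - z) - norm (X n - v)\<bar> \<le> e" for n
    using norm_triangle_ineq3[of "X n - z" "X n - v"] v(2) by (simp add: dist_norm)
  then show "\<exists>g. convergent g \<and> (\<forall>n. \<bar>norm (X n - z) - g n\<bar> \<le> e)" using assms(1)[OF v(1)] by blast
qed

section \<open>Square-integrable functions\<close>

lemma powr_2_eq_power2: "norm x powr 2 = (norm x)\<^sup>2"
  by (simp add: powr_numeral)

lemma Lp_space_2_iff:
  "x \<in> Lp_space M X 2 S \<longleftrightarrow>
     x \<in> borel_measurable X \<and> integrable M (\<lambda>\<omega>. (norm (x \<omega>))\<^sup>2) \<and> (AE \<omega> in M. x \<omega> \<in> S)"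
  by (simp add: Lp_space_def powr_2_eq_power2)

lemma Lp_space_1_iff:
  fixes x :: "'w \<Rightarrow> 'h :: {banach, second_countable_topology}"
  assumes "subalgebra M X"
  shows "x \<in> Lp_space M X 1 S \<longleftrightarrow> x \<in> borel_measurable X \<and> integrable M x \<and> (AE \<omega> in M. x \<omega> \<in> S)"
proof -
  have "integrable M (\<lambda>\<omega>. norm (x \<omega>)) \<longleftrightarrow> integrable M x" if "x \<in> borel_measurable X"
    by (rule integrable_norm_iff[OF measurable_from_subalg[OF assms that]])
  then show ?thesis by (simp add: Lp_space_def cong: conj_cong)
qed

lemma Lp_norm_2_power2:
  "(Lp_norm M 2 x)\<^sup>2 = (\<integral>\<omega>. (norm (x \<omega>))\<^sup>2 \<partial>M)"
proof -
  have "0 \<le> (\<integral>\<omega>. (norm (x \<omega>))\<^sup>2 \<partial>M)" by simp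
  then show ?thesis by (simp add: Lp_norm_def powr_2_eq_power2 powr_half_sqrt)
qed

lemma Lp_norm_1: "Lp_norm M 1 x = (\<integral>\<omega>. norm (x \<omega>) \<partial>M)"
  by (simp add: Lp_norm_def)

lemma norm_diff_power2_le:
  fixes x y :: "'h :: real_normed_vector"
  shows "(norm (x - y))\<^sup>2 \<le> 2 * (norm x)\<^sup>2 + 2 * (norm y)\<^sup>2"
proof -
  have "(norm (x - y))\<^sup>2 \<le> (norm x + norm y)\<^sup>2" by (intro power_mono norm_triangle_ineq4) simp
  also have "\<dots> \<le> 2 * (norm x)\<^sup>2 + 2 * (norm y)\<^sup>2"
    using sum_squares_bound[of "norm x" "norm y"] by (simp add: power2_sum)
  finally show ?thesis .
qed

lemma integrable_norm_power2_diff: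
  fixes x y :: "'w \<Rightarrow> 'h :: {real_normed_vector, second_countable_topology}"
  assumes [measurable]: "x \<in> borel_measurable M" "y \<in> borel_measurable M"
    and "integrable M (\<lambda>\<omega>. (norm (x \<omega>))\<^sup>2)" "integrable M (\<lambda>\<omega>. (norm (y \<omega>))\<^sup>2)"
  shows "integrable M (\<lambda>\<omega>. (norm (x \<omega> - y \<omega>))\<^sup>2)"
proof (rule Bochner_Integration.integrable_bound)
  show "integrable M (\<lambda>\<omega>. 2 * (norm (x \<omega>))\<^sup>2 + 2 * (norm (y \<omega>))\<^sup>2)" using assms by simp
qed (use norm_diff_power2_le in auto)

lemma integrable_norm_mult:
  fixes x :: "'w \<Rightarrow> 'h :: {real_normed_vector, second_countable_topology}"
    and y :: "'w \<Rightarrow> 'k :: {real_normed_vector, second_countable_topology}"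
  assumes [measurable]: "x \<in> borel_measurable M" "y \<in> borel_measurable M"
    and "integrable M (\<lambda>\<omega>. (norm (x \<omega>))\<^sup>2)" "integrable M (\<lambda>\<omega>. (norm (y \<omega>))\<^sup>2)"
  shows "integrable M (\<lambda>\<omega>. norm (x \<omega>) * norm (y \<omega>))"
proof (rule Bochner_Integration.integrable_bound)
  show "integrable M (\<lambda>\<omega>. (norm (x \<omega>))\<^sup>2 + (norm (y \<omega>))\<^sup>2)" using assms by simp
  have "norm a * norm b \<le> (norm a)\<^sup>2 + (norm b)\<^sup>2" for a :: 'h and b :: 'k
    using sum_squares_bound[of "norm a" "norm b"] mult_nonneg_nonneg[of "norm a" "norm b"] by (simp del: mult_nonneg_nonneg)
  then show "AE \<omega> in M. norm (norm (x \<omega>) * norm (y \<omega>)) \<le> norm ((norm (x \<omega>))\<^sup>2 + (norm (y \<omega>))\<^sup>2)"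
    by simp
qed simp

lemma integrable_inner:
  fixes x y :: "'w \<Rightarrow> 'h :: {real_inner, second_countable_topology}"
  assumes [measurable]: "x \<in> borel_measurable M" "y \<in> borel_measurable M"
    and "integrable M (\<lambda>\<omega>. (norm (x \<omega>))\<^sup>2)" "integrable M (\<lambda>\<omega>. (norm (y \<omega>))\<^sup>2)"
  shows "integrable M (\<lambda>\<omega>. x \<omega> \<bullet> y \<omega>)"
  by (rule Bochner_Integration.integrable_bound[OF integrable_norm_mult[OF assms]])
    (use Cauchy_Schwarz_ineq2 in auto)

lemma integrable_mult_ess_bounded:
  fixes f l :: "'w \<Rightarrow> real"
  assumes f: "integrable M f" and [measurable]: "l \<in> borel_measurable M"
    and bd: "AE \<omega> in M. \<bar>l \<omega>\<bar> \<le> C"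
  shows "integrable M (\<lambda>\<omega>. l \<omega> * f \<omega>)"
proof (rule Bochner_Integration.integrable_bound)
  show "integrable M (\<lambda>\<omega>. C * f \<omega>)" using f by simp
  show "(\<lambda>\<omega>. l \<omega> * f \<omega>) \<in> borel_measurable M" using f by measurable
  show "AE \<omega> in M. norm (l \<omega> * f \<omega>) \<le> norm (C * f \<omega>)"
    using bd by eventually_elim (auto simp: abs_mult intro!: mult_right_mono)
qed

lemma integrable_of_integrable_power2:
  fixes x :: "'w \<Rightarrow> 'h :: {banach, second_countable_topology}"
  assumes "finite_measure M" "x \<in> borel_measurable M" "integrable M (\<lambda>\<omega>. (norm (x \<omega>))\<^sup>2)"
  shows "integrable M x"
proof -
  interpret finite_measure M by fact
  have "integrable M (\<lambda>\<omega>. norm (x \<omega>) * norm (1 :: real))"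
    by (rule integrable_norm_mult) (use assms in auto)
  then show ?thesis using assms by (simp add: integrable_norm_iff)
qed

text \<open>
  Uniform integrability, in the form needed both for convergence in \<open>L\<^sup>1\<close> (\<open>k = 1\<close>) and for
  weak convergence in \<open>L\<^sup>2\<close>. By Young's inequality the part of \<open>\<bar>f n\<bar>\<close> above
  \<open>\<eta> * (h n)\<^sup>2\<close> is dominated by a multiple of the integrable function \<open>k\<^sup>2\<close>, so that its
  integral tends to \<open>0\<close> by dominated convergence; the rest has integral at most \<open>\<eta> * C\<close>.
\<close>
lemma integral_dominated_by_L2_products:
  fixes f h :: "nat \<Rightarrow> 'w \<Rightarrow> real" and k :: "'w \<Rightarrow> real"
  assumes f[measurable]: "\<And>n. f n \<in> borel_measurable M" and lim: "AE \<omega> in M. (\<lambda>n. f n \<omega>) \<longlonglongrightarrow> 0"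
    and h[measurable]: "\<And>n. h n \<in> borel_measurable M" and int_h: "\<And>n. integrable M (\<lambda>\<omega>. (h n \<omega>)\<^sup>2)"
    and bd: "\<And>n. (\<integral>\<omega>. (h n \<omega>)\<^sup>2 \<partial>M) \<le> C"
    and k[measurable]: "k \<in> borel_measurable M" and int_k: "integrable M (\<lambda>\<omega>. (k \<omega>)\<^sup>2)"
    and dom: "\<And>n. AE \<omega> in M. \<bar>f n \<omega>\<bar> \<le> \<bar>h n \<omega>\<bar> * \<bar>k \<omega>\<bar>"
  shows "(\<lambda>n. \<integral>\<omega>. \<bar>f n \<omega>\<bar> \<partial>M) \<longlonglongrightarrow> 0"
proof (rule LIMSEQ_I)
  fix r :: real assume r: "r > 0"
  have C: "C \<ge> 0" using bd[of 0] by (rule order_trans[rotated]) simp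
  \<comment> \<open>The remaining part must stay below \<open>r / 2\<close>; the summand \<open>1\<close> covers \<open>C = 0\<close>.\<close>
  define \<eta> where "\<eta> = r / (4 * (C + 1))"
  have "\<eta> * C = r / 4 * (C / (C + 1))" by (simp add: \<eta>_def)
  also have "\<dots> \<le> r / 4 * 1" using r C by (intro mult_left_mono) auto
  finally have "\<eta> * C < r / 2" using r by simp
  moreover have "\<eta> > 0" using r C by (simp add: \<eta>_def)
  ultimately have \<eta>: "\<eta> > 0" "\<eta> * C < r / 2" by auto
  define g where "g n \<omega> = max 0 (\<bar>f n \<omega>\<bar> - \<eta> * (h n \<omega>)\<^sup>2)" for n \<omega>
  have young: "\<bar>a\<bar> * \<bar>b\<bar> \<le> \<eta> * a\<^sup>2 + b\<^sup>2 / (4 * \<eta>)" for a b :: real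
  proof -
    have "0 \<le> (2 * \<eta> * \<bar>a\<bar> - \<bar>b\<bar>)\<^sup>2 / (4 * \<eta>)" using \<eta>(1) by simp
    also have "\<dots> = \<eta> * a\<^sup>2 + b\<^sup>2 / (4 * \<eta>) - \<bar>a\<bar> * \<bar>b\<bar>"
      using \<eta>(1) by (simp add: power2_diff field_simps power2_eq_square)
    finally show ?thesis by simp
  qed
  have g_bd: "AE \<omega> in M. norm (g n \<omega>) \<le> (k \<omega>)\<^sup>2 / (4 * \<eta>)" for n
    using dom[of n]
  proof eventually_elim
    case (elim \<omega>)
    have "\<bar>f n \<omega>\<bar> \<le> \<eta> * (h n \<omega>)\<^sup>2 + (k \<omega>)\<^sup>2 / (4 * \<eta>)" using elim young order_trans by blast
    then show ?case using \<eta>(1) by (auto simp: g_def)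
  qed
  have g_lim: "AE \<omega> in M. (\<lambda>n. g n \<omega>) \<longlonglongrightarrow> 0"
    using lim
  proof eventually_elim
    case (elim \<omega>)
    have "(\<lambda>n. \<bar>f n \<omega>\<bar>) \<longlonglongrightarrow> 0" using elim by (rule tendsto_rabs_zero)
    then show ?case
    proof (rule tendsto_sandwich[OF always_eventually always_eventually tendsto_const, rotated 2])
      show "\<forall>n. g n \<omega> \<le> \<bar>f n \<omega>\<bar>" using \<eta>(1) by (auto simp: g_def)
    qed (simp add: g_def)
  qed
  have [measurable]: "g n \<in> borel_measurable M" for n unfolding g_def by measurable
  have int_k': "integrable M (\<lambda>\<omega>. (k \<omega>)\<^sup>2 / (4 * \<eta>))" using int_k by simp
  have int_g: "integrable M (g n)" for n
    by (rule integrable_dominated_convergence2[where f="\<lambda>_. 0" and s=g, OF _ _ int_k' g_lim g_bd]) auto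
  have "(\<lambda>n. \<integral>\<omega>. g n \<omega> \<partial>M) \<longlonglongrightarrow> (\<integral>\<omega>. 0 \<partial>M)"
    by (rule integral_dominated_convergence[OF _ _ int_k' g_lim g_bd]) auto
  then have "(\<lambda>n. \<integral>\<omega>. g n \<omega> \<partial>M) \<longlonglongrightarrow> 0" by simp
  from LIMSEQ_D[OF this, of "r / 2"] r obtain N where N: "\<And>n. n \<ge> N \<Longrightarrow> \<bar>\<integral>\<omega>. g n \<omega> \<partial>M\<bar> < r / 2"
    by auto
  have "norm ((\<integral>\<omega>. \<bar>f n \<omega>\<bar> \<partial>M) - 0) < r" if "n \<ge> N" for n
  proof -
    have "(\<integral>\<omega>. \<bar>f n \<omega>\<bar> \<partial>M) \<le> (\<integral>\<omega>. g n \<omega> + \<eta> * (h n \<omega>)\<^sup>2 \<partial>M)"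
      by (rule integral_mono') (auto simp: g_def intro!: Bochner_Integration.integrable_add integrable_mult_right int_g[unfolded g_def] int_h)
    also have "\<dots> = (\<integral>\<omega>. g n \<omega> \<partial>M) + \<eta> * (\<integral>\<omega>. (h n \<omega>)\<^sup>2 \<partial>M)"
      using int_g int_h by simp
    also have "\<dots> < r / 2 + r / 2"
      using N[OF that] mult_left_mono[OF bd[of n], of \<eta>] \<eta> by linarith
    finally have "(\<integral>\<omega>. \<bar>f n \<omega>\<bar> \<partial>M) < r" by simp
    moreover have "0 \<le> (\<integral>\<omega>. \<bar>f n \<omega>\<bar> \<partial>M)" by simp
    ultimately show ?thesis by simp
  qed
  then show "\<exists>N. \<forall>n\<ge>N. norm ((\<integral>\<omega>. \<bar>f n \<omega>\<bar> \<partial>M) - 0) < r" by blast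
qed

corollary integral_tendsto_0_of_L2_bounded:
  fixes f :: "nat \<Rightarrow> 'w \<Rightarrow> real"
  assumes "finite_measure M" "\<And>n. f n \<in> borel_measurable M" "AE \<omega> in M. (\<lambda>n. f n \<omega>) \<longlonglongrightarrow> 0"
    and "\<And>n. integrable M (\<lambda>\<omega>. (f n \<omega>)\<^sup>2)" "\<And>n. (\<integral>\<omega>. (f n \<omega>)\<^sup>2 \<partial>M) \<le> C"
  shows "(\<lambda>n. \<integral>\<omega>. \<bar>f n \<omega>\<bar> \<partial>M) \<longlonglongrightarrow> 0"
proof -
  interpret finite_measure M by fact
  show ?thesis
    by (rule integral_dominated_by_L2_products[where h=f and k="\<lambda>_. 1"]) (use assms in auto)
qed

text \<open>
  The last hypothesis says that \<open>(g \<omega>)\<^sup>2\<close> is at most the lower limit of \<open>(h n \<omega>)\<^sup>2\<close>, in a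
  form that avoids extended reals. It is satisfied by pointwise limits and by norms of weak
  limits.
\<close>
lemma Fatou_L2:
  fixes h :: "nat \<Rightarrow> 'w \<Rightarrow> real" and g :: "'w \<Rightarrow> real"
  assumes int_h: "\<And>n. integrable M (\<lambda>\<omega>. (h n \<omega>)\<^sup>2)"
    and bd: "\<And>n. (\<integral>\<omega>. (h n \<omega>)\<^sup>2 \<partial>M) \<le> C"
    and g: "g \<in> borel_measurable M"
    and lsc: "AE \<omega> in M. \<forall>c. (\<exists>\<^sub>F n in sequentially. (h n \<omega>)\<^sup>2 < c) \<longrightarrow> (g \<omega>)\<^sup>2 \<le> c"
  shows "integrable M (\<lambda>\<omega>. (g \<omega>)\<^sup>2)"
proof -
  have [measurable]: "(\<lambda>\<omega>. (h n \<omega>)\<^sup>2) \<in> borel_measurable M" for n using int_h by auto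
  have "(\<integral>\<^sup>+\<omega>. ennreal ((g \<omega>)\<^sup>2) \<partial>M) \<le> (\<integral>\<^sup>+\<omega>. liminf (\<lambda>n. ennreal ((h n \<omega>)\<^sup>2)) \<partial>M)"
  proof (rule nn_integral_mono_AE)
    show "AE \<omega> in M. ennreal ((g \<omega>)\<^sup>2) \<le> liminf (\<lambda>n. ennreal ((h n \<omega>)\<^sup>2))"
      using lsc
    proof eventually_elim
      case (elim \<omega>)
      show ?case
      proof (rule ccontr)
        assume "\<not> ?thesis"
        then have less: "liminf (\<lambda>n. ennreal ((h n \<omega>)\<^sup>2)) < ennreal ((g \<omega>)\<^sup>2)" by simp
        then obtain c where c: "liminf (\<lambda>n. ennreal ((h n \<omega>)\<^sup>2)) < c" "c < ennreal ((g \<omega>)\<^sup>2)"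
          using dense by blast
        then obtain c' where c': "c = ennreal c'" "c' \<ge> 0"
          by (cases c) auto
        have "\<exists>\<^sub>F n in sequentially. (h n \<omega>)\<^sup>2 < c'"
        proof (rule ccontr)
          assume "\<not> ?thesis"
          then have "\<forall>\<^sub>F n in sequentially. c \<le> ennreal ((h n \<omega>)\<^sup>2)"
            unfolding c' by (simp add: frequently_def not_less ennreal_leI)
          then have "c \<le> liminf (\<lambda>n. ennreal ((h n \<omega>)\<^sup>2))" by (rule Liminf_bounded)
          then show False using c by simp
        qed
        then have "(g \<omega>)\<^sup>2 \<le> c'" using elim by blast
        then show False using c(2) c' by (simp add: ennreal_leI leD)
      qed
    qed
  qed
  also have "\<dots> \<le> liminf (\<lambda>n. \<integral>\<^sup>+\<omega>. ennreal ((h n \<omega>)\<^sup>2) \<partial>M)"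
    by (rule nn_integral_liminf) simp
  also have "\<dots> \<le> ennreal C"
    by (rule Liminf_le) (simp_all add: nn_integral_eq_integral[OF int_h] ennreal_leI bd)
  finally have "(\<integral>\<^sup>+\<omega>. ennreal ((g \<omega>)\<^sup>2) \<partial>M) < \<infinity>" by (simp add: order.strict_trans1)
  then show ?thesis using g by (intro integrableI_nonneg) auto
qed

section \<open>Measurability on complete measure spaces\<close>

lemma (in complete_measure) borel_measurable_AE_eq:
  fixes f g :: "'a \<Rightarrow> 'b :: topological_space"
  assumes g: "g \<in> borel_measurable M" and eq: "AE \<omega> in M. f \<omega> = g \<omega>"
  shows "f \<in> borel_measurable M"
proof (rule measurableI)
  fix A :: "'b set" assume A: "A \<in> sets borel"
  show "f -` A \<inter> space M \<in> sets M"
  proof (rule in_sets_AE)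
    show "AE \<omega> in M. \<omega> \<in> g -` A \<inter> space M \<longleftrightarrow> \<omega> \<in> f -` A \<inter> space M"
      using eq by eventually_elim auto
  qed (use measurable_sets[OF g A] in auto)
qed simp

lemma (in complete_measure) borel_measurable_AE_lim:
  fixes f :: "nat \<Rightarrow> 'a \<Rightarrow> 'b :: {banach, second_countable_topology}"
  assumes f[measurable]: "\<And>n. f n \<in> borel_measurable M" and lim: "AE \<omega> in M. (\<lambda>n. f n \<omega>) \<longlonglongrightarrow> g \<omega>"
  shows "g \<in> borel_measurable M"
proof (rule borel_measurable_AE_eq)
  show "(\<lambda>\<omega>. lim (\<lambda>n. f n \<omega>)) \<in> borel_measurable M" by measurable
  show "AE \<omega> in M. g \<omega> = lim (\<lambda>n. f n \<omega>)" using lim by eventually_elim (simp add: limI)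
qed

lemma norm_le_iff_inner_dense:
  fixes v :: "'h :: real_inner"
  assumes "closure D = UNIV" "0 \<le> r"
  shows "norm v \<le> r \<longleftrightarrow> (\<forall>u\<in>D. v \<bullet> u \<le> r * norm u)"
proof
  assume "norm v \<le> r"
  then show "\<forall>u\<in>D. v \<bullet> u \<le> r * norm u"
    by (meson Cauchy_Schwarz_ineq2 abs_le_D1 mult_right_mono norm_ge_zero order_trans)
next
  assume *: "\<forall>u\<in>D. v \<bullet> u \<le> r * norm u"
  have "closed {u. v \<bullet> u \<le> r * norm u}" by (intro closed_Collect_le continuous_intros)
  then have "closure D \<subseteq> {u. v \<bullet> u \<le> r * norm u}" using * by (intro closure_minimal) auto
  then have "v \<bullet> v \<le> r * norm v" using assms by auto
  then have "norm v * norm v \<le> r * norm v" by (simp add: dot_square_norm power2_eq_square)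
  then show "norm v \<le> r" using assms(2) by (cases "v = 0") auto
qed

text \<open>
  Pettis' theorem: membership in a closed ball is a countable conjunction of inequalities between
  inner products, and an open set is a countable union of closed balls.
\<close>
lemma borel_measurable_of_inner:
  fixes f :: "'w \<Rightarrow> 'h :: {real_inner, second_countable_topology}"
  assumes inner[measurable]: "\<And>u. (\<lambda>\<omega>. f \<omega> \<bullet> u) \<in> borel_measurable M"
  shows "f \<in> borel_measurable M"
proof -
  obtain D :: "'h set" where D: "countable D" "UNIV \<subseteq> closure D"
    using separable[of "UNIV :: 'h set"] by metis
  then have clD: "closure D = UNIV" by auto
  have cball: "f -` cball c r \<inter> space M \<in> sets M" for c r
  proof (cases "r \<ge> 0")
    case True
    have "f -` cball c r \<inter> space M = {\<omega>\<in>space M. \<forall>u\<in>D. (f \<omega> \<bullet> u) - (c \<bullet> u) \<le> r * norm u}"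
      by (auto simp: dist_norm norm_minus_commute[of c] norm_le_iff_inner_dense[OF clD True]
          simp flip: inner_diff_left)
    also have "\<dots> \<in> sets M" using D(1) by measurable
    finally show ?thesis .
  next
    case False
    then have "f -` cball c r \<inter> space M = {}" by (auto simp: cball_empty)
    then show ?thesis by (metis sets.empty_sets)
  qed
  show ?thesis
  proof (rule borel_measurableI)
    fix S :: "'h set" assume S: "open S"
    define \<B> where "\<B> = {ball c r | c r. cball c r \<subseteq> S}"
    have "open B" if "B \<in> \<B>" for B using that by (auto simp: \<B>_def)
    then obtain \<B>' where B': "\<B>' \<subseteq> \<B>" "countable \<B>'" "\<Union>\<B>' = \<Union>\<B>"
      by (rule Lindelof)
    have "\<forall>B\<in>\<B>'. \<exists>c r. B = ball c r \<and> cball c r \<subseteq> S" using B'(1) by (auto simp: \<B>_def)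
    then obtain c r where cr: "\<And>B. B \<in> \<B>' \<Longrightarrow> B = ball (c B) (r B) \<and> cball (c B) (r B) \<subseteq> S"
      by metis
    have "S = (\<Union>B\<in>\<B>'. cball (c B) (r B))"
    proof (intro equalityI subsetI)
      fix s assume "s \<in> S"
      then obtain e where "e > 0" "cball s e \<subseteq> S" using S open_contains_cball by blast
      then have "s \<in> \<Union>\<B>" unfolding \<B>_def by (auto intro!: exI[of _ "ball s e"])
      then have "s \<in> \<Union>\<B>'" using B' by simp
      then obtain B where B: "B \<in> \<B>'" "s \<in> B" by blast
      then have "s \<in> cball (c B) (r B)" using cr[OF B(1)] ball_subset_cball by blast
      then show "s \<in> (\<Union>B\<in>\<B>'. cball (c B) (r B))" using B(1) by blast
    next
      fix s assume "s \<in> (\<Union>B\<in>\<B>'. cball (c B) (r B))"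
      then show "s \<in> S" using cr by blast
    qed
    then have "f -` S \<inter> space M = (\<Union>B\<in>\<B>'. f -` cball (c B) (r B) \<inter> space M)" by blast
    also have "\<dots> \<in> sets M" using B'(2) cball by (intro sets.countable_UN') auto
    finally show "f -` S \<inter> space M \<in> sets M" .
  qed
qed

text \<open>
  The limit is chosen path by path; uniqueness of weak limits and completeness of the measure
  make any such choice measurable.
\<close>
lemma (in complete_measure) measurable_weak_limit:
  fixes X :: "nat \<Rightarrow> 'a \<Rightarrow> 'h :: {real_inner, second_countable_topology}"
  assumes X[measurable]: "\<And>n. X n \<in> borel_measurable M" and "Z \<noteq> {}"
    and ex: "AE \<omega> in M. \<exists>l\<in>Z. weakly_converges (\<lambda>n. X n \<omega>) l"
  shows "\<exists>y \<in> M \<rightarrow>\<^sub>M restrict_space borel Z. AE \<omega> in M. weakly_converges (\<lambda>n. X n \<omega>) (y \<omega>)"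
proof -
  obtain z where z: "z \<in> Z" using \<open>Z \<noteq> {}\<close> by blast
  \<comment> \<open>The point \<open>z\<close> is used on the null set without weak limit, so that \<open>y\<close> is \<open>Z\<close>-valued everywhere.\<close>
  define y where "y \<omega> = (if \<exists>l\<in>Z. weakly_converges (\<lambda>n. X n \<omega>) l
    then SOME l. l \<in> Z \<and> weakly_converges (\<lambda>n. X n \<omega>) l else z)" for \<omega>
  have y: "y \<omega> \<in> Z \<and> weakly_converges (\<lambda>n. X n \<omega>) (y \<omega>)" if "\<exists>l\<in>Z. weakly_converges (\<lambda>n. X n \<omega>) l" for \<omega>
    using that someI_ex[of "\<lambda>l. l \<in> Z \<and> weakly_converges (\<lambda>n. X n \<omega>) l"] by (auto simp: y_def)
  then have y_Z: "y \<omega> \<in> Z" for \<omega> using z by (cases "\<exists>l\<in>Z. weakly_converges (\<lambda>n. X n \<omega>) l") (auto simp: y_def)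
  have conv: "AE \<omega> in M. weakly_converges (\<lambda>n. X n \<omega>) (y \<omega>)"
    using ex by eventually_elim (use y in blast)
  have "y \<in> borel_measurable M"
  proof (rule borel_measurable_of_inner)
    fix u
    show "(\<lambda>\<omega>. y \<omega> \<bullet> u) \<in> borel_measurable M"
    proof (rule borel_measurable_AE_lim)
      show "(\<lambda>\<omega>. X n \<omega> \<bullet> u) \<in> borel_measurable M" for n by measurable
      show "AE \<omega> in M. (\<lambda>n. X n \<omega> \<bullet> u) \<longlonglongrightarrow> y \<omega> \<bullet> u"
        using conv by eventually_elim (simp add: weakly_converges_def)
    qed
  qed
  then have "y \<in> M \<rightarrow>\<^sub>M restrict_space borel Z" using y_Z by (intro measurable_restrict_space2) auto
  then show ?thesis using conv by blast
qed

text \<open>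
  The approximant is the first member of a dense sequence of \<open>Z\<close> that is close enough to
  \<open>z \<omega>\<close>. It has countably many values, and its index is measurable.
\<close>
lemma dense_valued_approximation:
  fixes Z :: "'h :: {metric_space, second_countable_topology} set" and z :: "'w \<Rightarrow> 'h"
  assumes "Z \<noteq> {}" and z[measurable]: "z \<in> borel_measurable F"
  obtains e :: "nat \<Rightarrow> 'h" and idx :: "nat \<Rightarrow> 'w \<Rightarrow> nat"
  where "range e \<subseteq> Z" and "\<And>k. idx k \<in> F \<rightarrow>\<^sub>M count_space UNIV"
    and "\<And>k \<omega>. z \<omega> \<in> Z \<Longrightarrow> dist (e (idx k \<omega>)) (z \<omega>) < inverse (real (Suc k))"
proof -
  obtain D where D: "countable D" "D \<subseteq> Z" "Z \<subseteq> closure D" using separable[of Z] by metis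
  have "D \<noteq> {}" using D assms(1) by auto
  define e where "e = from_nat_into D"
  have range_e: "range e = D" using D(1) \<open>D \<noteq> {}\<close> by (simp add: e_def range_from_nat_into)
  define idx where "idx k \<omega> = (LEAST j. dist (e j) (z \<omega>) < inverse (real (Suc k)))" for k \<omega>
  show ?thesis
  proof (rule that)
    show "range e \<subseteq> Z" using range_e D by simp
    show "idx k \<in> F \<rightarrow>\<^sub>M count_space UNIV" for k
      unfolding idx_def by measurable
    fix k \<omega> assume "z \<omega> \<in> Z"
    then have "z \<omega> \<in> closure (range e)" using D range_e by auto
    then have "\<exists>j. dist (e j) (z \<omega>) < inverse (real (Suc k))"
      unfolding closure_approachable by (metis imageE inverse_positive_iff_positive of_nat_0_less_iff zero_less_Suc)
    then show "dist (e (idx k \<omega>)) (z \<omega>) < inverse (real (Suc k))"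
      unfolding idx_def by (rule LeastI_ex)
  qed
qed

lemma tendsto_of_dist_less_inverse:
  assumes "\<And>k. dist (f k) l < inverse (real (Suc k))"
  shows "f \<longlonglongrightarrow> l"
proof (rule metric_tendsto_imp_tendsto[OF LIMSEQ_inverse_real_of_nat])
  show "\<forall>\<^sub>F k in sequentially. dist (f k) l \<le> dist (inverse (real (Suc k))) 0"
    using assms by (auto intro!: always_eventually less_imp_le)
qed

text \<open>
  Along approximants with countably many values, \<open>\<phi>\<close> is pieced together from the measurable
  functions \<open>\<phi> _ v\<close>; continuity passes to the limit.
\<close>
lemma (in complete_measure) borel_measurable_Caratheodory:
  fixes z :: "'a \<Rightarrow> 'h :: {metric_space, second_countable_topology}" and \<phi> :: "'a \<Rightarrow> 'h \<Rightarrow> real"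
  assumes cont: "AE \<omega> in M. continuous_on UNIV (\<phi> \<omega>)"
    and meas: "\<And>v. (\<lambda>\<omega>. \<phi> \<omega> v) \<in> borel_measurable M"
    and z: "z \<in> borel_measurable M"
  shows "(\<lambda>\<omega>. \<phi> \<omega> (z \<omega>)) \<in> borel_measurable M"
proof -
  obtain e and idx :: "nat \<Rightarrow> 'a \<Rightarrow> nat" where idx: "\<And>k. idx k \<in> M \<rightarrow>\<^sub>M count_space UNIV"
    and e: "\<And>k \<omega>. z \<omega> \<in> UNIV \<Longrightarrow> dist (e (idx k \<omega>)) (z \<omega>) < inverse (real (Suc k))"
    using dense_valued_approximation[OF UNIV_not_empty z] by metis
  show ?thesis
  proof (rule borel_measurable_AE_lim)
    show "(\<lambda>\<omega>. \<phi> \<omega> (e (idx k \<omega>))) \<in> borel_measurable M" for k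
      by (rule measurable_compose_countable[OF meas idx])
    show "AE \<omega> in M. (\<lambda>k. \<phi> \<omega> (e (idx k \<omega>))) \<longlonglongrightarrow> \<phi> \<omega> (z \<omega>)"
      using cont
    proof eventually_elim
      case (elim \<omega>)
      show ?case
        by (rule continuous_on_tendsto_compose[OF elim tendsto_of_dist_less_inverse[OF e]]) auto
    qed
  qed
qed

section \<open>Conditional inequalities at a random point\<close>

text \<open>
  Conditional expectation is local: it commutes with multiplication by the indicator of
  \<open>A\<close>.
\<close>
lemma (in sigma_finite_subalgebra) real_cond_exp_cong_on:
  assumes A: "A \<in> sets F" and f: "integrable M f" and g: "integrable M g"
    and eq: "\<And>\<omega>. \<omega> \<in> A \<Longrightarrow> f \<omega> = g \<omega>"
  shows "AE \<omega> in M. \<omega> \<in> A \<longrightarrow> real_cond_exp M F f \<omega> = real_cond_exp M F g \<omega>"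
proof -
  have [measurable]: "A \<in> sets M" using A subalg by (auto simp: subalgebra_def)
  have [measurable]: "A \<in> sets F" by (rule A)
  have *: "AE \<omega> in M. real_cond_exp M F (\<lambda>\<omega>. indicator A \<omega> * h \<omega>) \<omega> = indicator A \<omega> * real_cond_exp M F h \<omega>"
    if "integrable M h" for h
    by (rule real_cond_exp_mult) (use that integrable_mult_indicator[OF \<open>A \<in> sets M\<close> that] in auto)
  have "(\<lambda>\<omega>. indicator A \<omega> * f \<omega>) = (\<lambda>\<omega>. indicator A \<omega> * g \<omega>)"
    using eq by (auto simp: fun_eq_iff indicator_def)
  with *[OF f] *[OF g] show ?thesis
    by (auto elim!: eventually_elim2 simp: indicator_def split: if_splits)
qed

text \<open>
  The exceptional null set of the hypothesis depends on \<open>v\<close>, and therefore \<open>z \<omega>\<close> cannot simply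
  be substituted for \<open>v\<close>. Only the countably many values of the approximants \<open>zk k\<close> of \<open>z\<close> are
  substituted, by locality. The passage from \<open>zk k\<close> to \<open>z\<close> uses continuity of \<open>\<phi>\<close> on the right
  and, on the left, that \<open>z - zk k\<close> is uniformly small while the conditional expectation of
  \<open>norm W\<close> is a fixed function.
\<close>
lemma (in sigma_finite_subalgebra) real_cond_exp_affine_le_random_point:
  fixes G :: "'a \<Rightarrow> real" and z W :: "'a \<Rightarrow> 'h :: {real_inner, second_countable_topology}"
  assumes G: "integrable M G" and W[measurable]: "W \<in> borel_measurable M"
    and nW: "integrable M (\<lambda>\<omega>. norm (W \<omega>))"
    and z[measurable]: "z \<in> borel_measurable F" and zW: "integrable M (\<lambda>\<omega>. norm (z \<omega>) * norm (W \<omega>))"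
    and zZ: "AE \<omega> in M. z \<omega> \<in> Z" and Z: "Z \<noteq> {}"
    and cont: "AE \<omega> in M. continuous_on UNIV (\<phi> \<omega>)"
    and le: "\<And>v. v \<in> Z \<Longrightarrow> AE \<omega> in M. real_cond_exp M F (\<lambda>\<omega>. G \<omega> + v \<bullet> W \<omega>) \<omega> \<le> \<phi> \<omega> v"
  shows "AE \<omega> in M. real_cond_exp M F (\<lambda>\<omega>. G \<omega> + z \<omega> \<bullet> W \<omega>) \<omega> \<le> \<phi> \<omega> (z \<omega>)"
proof -
  obtain e and idx :: "nat \<Rightarrow> 'a \<Rightarrow> nat" where range_e: "range e \<subseteq> Z"
    and idx[measurable]: "\<And>k. idx k \<in> F \<rightarrow>\<^sub>M count_space UNIV"
    and e: "\<And>k \<omega>. z \<omega> \<in> Z \<Longrightarrow> dist (e (idx k \<omega>)) (z \<omega>) < inverse (real (Suc k))"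
    using dense_valued_approximation[OF Z z] by metis
  have zM[measurable]: "z \<in> borel_measurable M" by (rule measurable_from_subalg[OF subalg z])
  have idxM[measurable]: "idx k \<in> M \<rightarrow>\<^sub>M count_space UNIV" for k
    by (rule measurable_from_subalg[OF subalg idx])
  define zk where "zk k \<omega> = e (idx k \<omega>)" for k \<omega>
  have [measurable]: "zk k \<in> borel_measurable M" for k
    unfolding zk_def by (rule measurable_compose_countable[OF _ idxM]) simp
  have dist_zk: "AE \<omega> in M. norm (zk k \<omega> - z \<omega>) \<le> inverse (real (Suc k))" for k
    using zZ by eventually_elim (use e in \<open>auto simp: zk_def dist_norm less_imp_le\<close>)
  have int_z: "integrable M (\<lambda>\<omega>. z \<omega> \<bullet> W \<omega>)"
    by (rule Bochner_Integration.integrable_bound[OF zW]) (use Cauchy_Schwarz_ineq2 in auto)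
  have int_zk: "integrable M (\<lambda>\<omega>. zk k \<omega> \<bullet> W \<omega>)" for k
  proof (rule Bochner_Integration.integrable_bound)
    show "integrable M (\<lambda>\<omega>. norm (z \<omega>) * norm (W \<omega>) + inverse (real (Suc k)) * norm (W \<omega>))"
      by (intro Bochner_Integration.integrable_add zW integrable_mult_right nW)
    show "AE \<omega> in M. norm (zk k \<omega> \<bullet> W \<omega>) \<le> norm (norm (z \<omega>) * norm (W \<omega>) + inverse (real (Suc k)) * norm (W \<omega>))"
      using dist_zk[of k]
    proof eventually_elim
      case (elim \<omega>)
      have "norm (zk k \<omega>) \<le> norm (z \<omega>) + inverse (real (Suc k))"
        using elim norm_triangle_sub[of "zk k \<omega>" "z \<omega>"] by linarith
      then have "\<bar>zk k \<omega> \<bullet> W \<omega>\<bar> \<le> (norm (z \<omega>) + inverse (real (Suc k))) * norm (W \<omega>)"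
        using Cauchy_Schwarz_ineq2 mult_right_mono norm_ge_zero order_trans by meson
      then show ?case by (simp add: distrib_right)
    qed
  qed simp
  have int_v: "integrable M (\<lambda>\<omega>. v \<bullet> W \<omega>)" for v
    by (rule Bochner_Integration.integrable_bound[OF integrable_mult_right[OF nW, of "norm v"]])
      (use Cauchy_Schwarz_ineq2 in auto)
  have le_all: "AE \<omega> in M. \<forall>j. real_cond_exp M F (\<lambda>\<omega>. G \<omega> + e j \<bullet> W \<omega>) \<omega> \<le> \<phi> \<omega> (e j)"
    using le range_e by (simp add: AE_all_countable image_subset_iff)
  have local: "AE \<omega> in M. \<forall>j. idx k \<omega> = j \<longrightarrow>
      real_cond_exp M F (\<lambda>\<omega>. G \<omega> + zk k \<omega> \<bullet> W \<omega>) \<omega> = real_cond_exp M F (\<lambda>\<omega>. G \<omega> + e j \<bullet> W \<omega>) \<omega>" for k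
    unfolding AE_all_countable
  proof
    fix j
    have "AE \<omega> in M. \<omega> \<in> {\<omega>\<in>space F. idx k \<omega> = j} \<longrightarrow>
      real_cond_exp M F (\<lambda>\<omega>. G \<omega> + zk k \<omega> \<bullet> W \<omega>) \<omega> = real_cond_exp M F (\<lambda>\<omega>. G \<omega> + e j \<bullet> W \<omega>) \<omega>"
    proof (rule real_cond_exp_cong_on)
      show "{\<omega>\<in>space F. idx k \<omega> = j} \<in> sets F" by measurable
    qed (auto simp: zk_def intro!: Bochner_Integration.integrable_add G int_zk[unfolded zk_def] int_v)
    moreover have "space F = space M" using subalg by (simp add: subalgebra_def)
    ultimately show "AE \<omega> in M. idx k \<omega> = j \<longrightarrow>
      real_cond_exp M F (\<lambda>\<omega>. G \<omega> + zk k \<omega> \<bullet> W \<omega>) \<omega> = real_cond_exp M F (\<lambda>\<omega>. G \<omega> + e j \<bullet> W \<omega>) \<omega>"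
      by (auto elim!: AE_mp intro!: AE_I2)
  qed
  let ?c = "\<lambda>k. inverse (real (Suc k))"
  have approx: "AE \<omega> in M. real_cond_exp M F (\<lambda>\<omega>. G \<omega> + z \<omega> \<bullet> W \<omega>) \<omega>
      \<le> real_cond_exp M F (\<lambda>\<omega>. G \<omega> + zk k \<omega> \<bullet> W \<omega>) \<omega> + ?c k * real_cond_exp M F (\<lambda>\<omega>. norm (W \<omega>)) \<omega>" for k
  proof -
    have int1: "integrable M (\<lambda>\<omega>. G \<omega> + zk k \<omega> \<bullet> W \<omega>)" "integrable M (\<lambda>\<omega>. ?c k * norm (W \<omega>))"
      using G int_zk nW by auto
    have "AE \<omega> in M. real_cond_exp M F (\<lambda>\<omega>. G \<omega> + z \<omega> \<bullet> W \<omega>) \<omega>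
        \<le> real_cond_exp M F (\<lambda>\<omega>. (G \<omega> + zk k \<omega> \<bullet> W \<omega>) + ?c k * norm (W \<omega>)) \<omega>"
    proof (rule real_cond_exp_mono)
      show "AE \<omega> in M. G \<omega> + z \<omega> \<bullet> W \<omega> \<le> (G \<omega> + zk k \<omega> \<bullet> W \<omega>) + ?c k * norm (W \<omega>)"
        using dist_zk[of k]
      proof eventually_elim
        case (elim \<omega>)
        have "z \<omega> \<bullet> W \<omega> - zk k \<omega> \<bullet> W \<omega> = (z \<omega> - zk k \<omega>) \<bullet> W \<omega>" by (simp add: inner_diff_left)
        also have "\<dots> \<le> norm (z \<omega> - zk k \<omega>) * norm (W \<omega>)"
          using Cauchy_Schwarz_ineq2 abs_le_D1 by blast
        also have "\<dots> \<le> ?c k * norm (W \<omega>)"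
          using elim by (intro mult_right_mono) (auto simp: norm_minus_commute)
        finally show ?case by linarith
      qed
    qed (use int1 G int_z in auto)
    with real_cond_exp_add[OF int1] real_cond_exp_cmult[OF nW, of "?c k"] show ?thesis
      by eventually_elim simp
  qed
  have "AE \<omega> in M. \<forall>k. real_cond_exp M F (\<lambda>\<omega>. G \<omega> + z \<omega> \<bullet> W \<omega>) \<omega>
      \<le> \<phi> \<omega> (zk k \<omega>) + ?c k * real_cond_exp M F (\<lambda>\<omega>. norm (W \<omega>)) \<omega>"
    unfolding AE_all_countable
  proof
    fix k
    show "AE \<omega> in M. real_cond_exp M F (\<lambda>\<omega>. G \<omega> + z \<omega> \<bullet> W \<omega>) \<omega>
      \<le> \<phi> \<omega> (zk k \<omega>) + ?c k * real_cond_exp M F (\<lambda>\<omega>. norm (W \<omega>)) \<omega>"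
      using approx[of k] le_all local[of k]
    proof eventually_elim
      case (elim \<omega>)
      have "real_cond_exp M F (\<lambda>\<omega>. G \<omega> + zk k \<omega> \<bullet> W \<omega>) \<omega> \<le> \<phi> \<omega> (zk k \<omega>)"
        using elim(2,3) by (simp add: zk_def)
      then show ?case using elim(1) by linarith
    qed
  qed
  with cont zZ show ?thesis
  proof eventually_elim
    case (elim \<omega>)
    have "(\<lambda>k. zk k \<omega>) \<longlonglongrightarrow> z \<omega>"
      unfolding zk_def using e[OF elim(2)] by (rule tendsto_of_dist_less_inverse)
    then have "(\<lambda>k. \<phi> \<omega> (zk k \<omega>)) \<longlonglongrightarrow> \<phi> \<omega> (z \<omega>)"
      by (rule continuous_on_tendsto_compose[OF elim(1)]) auto
    then have "(\<lambda>k. \<phi> \<omega> (zk k \<omega>) + ?c k * real_cond_exp M F (\<lambda>\<omega>. norm (W \<omega>)) \<omega>)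
        \<longlonglongrightarrow> \<phi> \<omega> (z \<omega>) + 0 * real_cond_exp M F (\<lambda>\<omega>. norm (W \<omega>)) \<omega>"
      by (intro tendsto_intros LIMSEQ_inverse_real_of_nat)
    then show ?case using elim(3) by (intro LIMSEQ_le_const[where X="\<lambda>k. \<phi> \<omega> (zk k \<omega>) + ?c k * real_cond_exp M F (\<lambda>\<omega>. norm (W \<omega>)) \<omega>"]) auto
  qed
qed

section \<open>Nonnegative supermartingales\<close>

text \<open>
  The strategy behind Doob's upcrossing inequality: buy when \<open>u\<close> is below \<open>a\<close>, and hold until
  \<open>u\<close> exceeds \<open>b\<close>.
\<close>
primrec holding :: "real \<Rightarrow> real \<Rightarrow> (nat \<Rightarrow> real) \<Rightarrow> nat \<Rightarrow> bool" where
  "holding a b u 0 \<longleftrightarrow> u 0 < a"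
| "holding a b u (Suc n) \<longleftrightarrow> (if holding a b u n then u (Suc n) \<le> b else u (Suc n) < a)"

primrec upcrossings :: "real \<Rightarrow> real \<Rightarrow> (nat \<Rightarrow> real) \<Rightarrow> nat \<Rightarrow> nat" where
  "upcrossings a b u 0 = 0"
| "upcrossings a b u (Suc n) =
     upcrossings a b u n + of_bool (holding a b u n \<and> \<not> holding a b u (Suc n))"

definition gain :: "real \<Rightarrow> real \<Rightarrow> (nat \<Rightarrow> real) \<Rightarrow> nat \<Rightarrow> real" where
  "gain a b u n = (\<Sum>k<n. of_bool (holding a b u k) * (u (Suc k) - u k))"

text \<open>
  Every completed upcrossing earns at least \<open>b - a\<close>. While \<open>u n\<close> is held, the loss since the last
  purchase is at most \<open>a - u n\<close>, hence at most \<open>a\<close> for a nonnegative sequence. The induction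
  carries the term \<open>u n - a\<close> of a current holding.
\<close>
lemma upcrossings_le_gain:
  assumes "0 \<le> a" "a < b" "\<And>n. 0 \<le> u n"
  shows "(b - a) * real (upcrossings a b u n) - a \<le> gain a b u n"
proof -
  have "(b - a) * real (upcrossings a b u n) + of_bool (holding a b u n) * (u n - a) \<le> gain a b u n"
  proof (induction n)
    case 0
    then show ?case by (simp add: gain_def)
  next
    case (Suc n)
    consider "holding a b u n" "u (Suc n) \<le> b" | "holding a b u n" "u (Suc n) > b"
      | "\<not> holding a b u n" by linarith
    then show ?case using Suc by cases (auto simp: gain_def algebra_simps)
  qed
  moreover have "- a \<le> of_bool (holding a b u n) * (u n - a)" using assms by auto
  ultimately show ?thesis by linarith
qed

lemma upcrossings_le: "upcrossings a b u n \<le> n"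
  by (induction n) auto

lemma upcrossings_mono: "m \<le> n \<Longrightarrow> upcrossings a b u m \<le> upcrossings a b u n"
  by (rule lift_Suc_mono_le) auto

text \<open>
  A sequence that is infinitely often below \<open>a\<close> and infinitely often above \<open>b\<close> makes the strategy
  buy and sell again after any time.
\<close>
lemma upcrossings_unbounded:
  assumes "a < b" and below: "\<exists>\<^sub>F n in sequentially. u n < a" and above: "\<exists>\<^sub>F n in sequentially. b < u n"
  shows "\<exists>n. K \<le> upcrossings a b u n"
proof -
  have enter: "\<exists>m\<ge>n. holding a b u m" for n
  proof (rule ccontr)
    assume *: "\<not> ?thesis"
    obtain m where m: "m > n" "u m < a" using below by (meson frequently_sequentially Suc_le_lessD)
    then obtain k where k: "m = Suc k" "k \<ge> n" by (cases m) auto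
    then have "holding a b u m" using * m by auto
    then show False using * m by auto
  qed
  have leave: "\<exists>m\<ge>n. \<not> holding a b u m" for n
  proof (rule ccontr)
    assume *: "\<not> ?thesis"
    obtain m where m: "m > n" "b < u m" using above by (meson frequently_sequentially Suc_le_lessD)
    then obtain k where k: "m = Suc k" "k \<ge> n" by (cases m) auto
    then have "\<not> holding a b u m" using * m by auto
    then show False using * m by auto
  qed
  have up: "\<exists>m. upcrossings a b u m \<ge> Suc (upcrossings a b u n)" for n
  proof -
    obtain p where p: "p \<ge> n" "holding a b u p" using enter by blast
    define q where "q = (LEAST q. p \<le> q \<and> \<not> holding a b u q)"
    have q: "p \<le> q" "\<not> holding a b u q"
      using LeastI_ex[OF leave[of p, folded Bex_def]] leave[of p] unfolding q_def
      by (metis (mono_tags, lifting) LeastI_ex)+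
    then obtain k where k: "q = Suc k" "k \<ge> p" using p by (cases q) (auto simp: le_Suc_eq)
    have "holding a b u k" using not_less_Least[of k "\<lambda>q. p \<le> q \<and> \<not> holding a b u q"] k q_def by auto
    then have "upcrossings a b u (Suc k) = Suc (upcrossings a b u k)" using q k by simp
    moreover have "upcrossings a b u n \<le> upcrossings a b u k" using p k by (intro upcrossings_mono) auto
    ultimately show ?thesis by (metis Suc_le_mono)
  qed
  show ?thesis
  proof (induction K)
    case (Suc K)
    then show ?case using up by (meson Suc_le_mono order_trans)
  qed auto
qed

text \<open>
  If the lower and the upper limit differ, then rational numbers strictly between them are crossed
  infinitely often. The condition on \<open>B\<close> excludes divergence to infinity.
\<close>
lemma convergent_of_finite_upcrossings:
  assumes nn: "\<And>n. 0 \<le> u n" and freq: "\<exists>\<^sub>F n in sequentially. u n \<le> B"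
    and up: "\<And>a b. a \<in> \<rat> \<Longrightarrow> b \<in> \<rat> \<Longrightarrow> 0 \<le> a \<Longrightarrow> a < b \<Longrightarrow> \<exists>K. \<forall>n. upcrossings a b u n \<le> K"
  shows "convergent u"
proof -
  let ?l = "liminf (\<lambda>n. ereal (u n))" and ?L = "limsup (\<lambda>n. ereal (u n))"
  have l0: "0 \<le> ?l" by (rule Liminf_bounded) (simp add: nn)
  have lB: "?l \<le> ereal B"
  proof (rule ccontr)
    assume "\<not> ?thesis"
    then have "\<forall>\<^sub>F n in sequentially. ereal B < ereal (u n)" by (intro less_LiminfD) simp
    then have "\<forall>\<^sub>F n in sequentially. \<not> u n \<le> B" by eventually_elim simp
    then show False using freq by (simp add: frequently_def)
  qed
  have "?l = ?L"
  proof (rule ccontr)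
    assume "?l \<noteq> ?L"
    then have "?l < ?L" using Liminf_le_Limsup[of sequentially "\<lambda>n. ereal (u n)"] by simp
    then obtain s where s: "?l < ereal s" "ereal s < ?L" using ereal_dense2 by blast
    then obtain t where t: "ereal s < ereal t" "ereal t < ?L" using ereal_dense2 by blast
    then obtain a where a: "a \<in> \<rat>" "s < a" "a < t" using Rats_dense_in_real by (metis less_ereal.simps(1))
    then obtain b where b: "b \<in> \<rat>" "a < b" "b < t" using Rats_dense_in_real by blast
    have la: "?l < ereal a" using s a by (meson less_ereal.simps(1) less_trans)
    have bL: "ereal b < ?L" using t b by (meson less_ereal.simps(1) less_trans)
    have "0 < ereal a" using l0 la by (rule le_less_trans)
    then have "0 \<le> a" by simp
    have "\<exists>\<^sub>F n in sequentially. u n < a"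
    proof (rule ccontr)
      assume "\<not> ?thesis"
      then have "\<forall>\<^sub>F n in sequentially. ereal a \<le> ereal (u n)" by (simp add: frequently_def not_less)
      then have "ereal a \<le> ?l" by (rule Liminf_bounded)
      then show False using la by simp
    qed
    moreover have "\<exists>\<^sub>F n in sequentially. b < u n"
    proof (rule ccontr)
      assume "\<not> ?thesis"
      then have "\<forall>\<^sub>F n in sequentially. ereal (u n) \<le> ereal b" by (simp add: frequently_def not_less)
      then have "?L \<le> ereal b" by (rule Limsup_bounded)
      then show False using bL by simp
    qed
    ultimately show False using upcrossings_unbounded[OF b(2)] up[OF a(1) b(1) \<open>0 \<le> a\<close> b(2)]
      by (metis Suc_n_not_le_n order_trans)
  qed
  moreover obtain r where r: "?l = ereal r" using l0 lB by (cases ?l) auto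
  ultimately have "(\<lambda>n. ereal (u n)) \<longlonglongrightarrow> ereal r"
    using tendsto_iff_Liminf_eq_Limsup[of sequentially "\<lambda>n. ereal (u n)" "ereal r"] by simp
  then show ?thesis by (auto simp: convergent_def)
qed

locale filtered_prob_space = prob_space M for M :: "'w measure" +
  fixes F :: "nat \<Rightarrow> 'w measure"
  assumes subalgebra_F: "subalgebra M (F n)"
    and sets_F_Suc: "sets (F n) \<subseteq> sets (F (Suc n))"
begin

lemma subalgebra_F_mono:
  assumes "m \<le> n"
  shows "subalgebra (F n) (F m)"
  using lift_Suc_mono_le[of "\<lambda>n. sets (F n)", OF sets_F_Suc assms] subalgebra_F
  by (auto simp: subalgebra_def)

lemma measurable_F_mono:
  assumes "f \<in> F m \<rightarrow>\<^sub>M N" "m \<le> n"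
  shows "f \<in> F n \<rightarrow>\<^sub>M N"
  using measurable_from_subalg[OF subalgebra_F_mono[OF assms(2)] assms(1)] .

lemma measurable_F: "f \<in> F n \<rightarrow>\<^sub>M N \<Longrightarrow> f \<in> M \<rightarrow>\<^sub>M N"
  using measurable_from_subalg[OF subalgebra_F] .

lemma sets_F: "A \<in> sets (F n) \<Longrightarrow> A \<in> sets M"
  using subalgebra_F by (auto simp: subalgebra_def)

lemma sigma_finite_subalgebra_F: "sigma_finite_subalgebra M (F n)"
  by (intro finite_measure_subalgebra_is_sigma_finite finite_measure_subalgebra.intro
      finite_measure_subalgebra_axioms.intro subalgebra_F) unfold_locales

lemma pred_holding:
  assumes U: "\<And>n. U n \<in> borel_measurable (F n)"
  shows "Measurable.pred (F n) (\<lambda>\<omega>. holding a b (\<lambda>k. U k \<omega>) n)"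
proof (induction n)
  case 0
  have [measurable]: "U 0 \<in> borel_measurable (F 0)" by (rule U)
  show ?case by simp
next
  case (Suc n)
  have [measurable]: "Measurable.pred (F (Suc n)) (\<lambda>\<omega>. holding a b (\<lambda>k. U k \<omega>) n)"
    by (rule measurable_F_mono[OF Suc]) simp
  have [measurable]: "U (Suc n) \<in> borel_measurable (F (Suc n))" by (rule U)
  show ?case by simp
qed

text \<open>
  By monotone convergence the supremum has finite expectation.
\<close>
lemma AE_bounded_of_monotone_expectation:
  fixes f :: "nat \<Rightarrow> 'w \<Rightarrow> real"
  assumes int: "\<And>n. integrable M (f n)" and nn: "\<And>n \<omega>. \<omega> \<in> space M \<Longrightarrow> 0 \<le> f n \<omega>"
    and mono: "\<And>n \<omega>. \<omega> \<in> space M \<Longrightarrow> f n \<omega> \<le> f (Suc n) \<omega>"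
    and bd: "\<And>n. (\<integral>\<omega>. f n \<omega> \<partial>M) \<le> C"
  shows "AE \<omega> in M. \<exists>K. \<forall>n. f n \<omega> \<le> K"
proof -
  have [measurable]: "f n \<in> borel_measurable M" for n using int by auto
  have "(\<integral>\<^sup>+\<omega>. (SUP n. ennreal (f n \<omega>)) \<partial>M) = (SUP n. \<integral>\<^sup>+\<omega>. ennreal (f n \<omega>) \<partial>M)"
    by (rule nn_integral_monotone_convergence_SUP_AE) (auto intro!: ennreal_leI mono)
  also have "\<dots> \<le> ennreal C"
    using bd by (intro SUP_least) (simp add: nn_integral_eq_integral[OF int] nn ennreal_leI)
  finally have "(\<integral>\<^sup>+\<omega>. (SUP n. ennreal (f n \<omega>)) \<partial>M) \<noteq> \<infinity>" by (auto simp: top_unique)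
  then have "AE \<omega> in M. (SUP n. ennreal (f n \<omega>)) \<noteq> \<infinity>" by (intro nn_integral_PInf_AE) auto
  then show ?thesis
  proof eventually_elim
    case (elim \<omega>)
    then obtain K where K: "(SUP n. ennreal (f n \<omega>)) = ennreal K" "K \<ge> 0"
      by (cases "SUP n. ennreal (f n \<omega>)") auto
    have "f n \<omega> \<le> K" for n
    proof -
      have "ennreal (f n \<omega>) \<le> ennreal K" unfolding K(1)[symmetric] by (rule SUP_upper) simp
      then show ?thesis using K(2) by simp
    qed
    then show ?case by blast
  qed
qed

text \<open>
  The decision to hold between times \<open>k\<close> and \<open>k + 1\<close> is made on the event \<open>A k\<close>, which is known
  at time \<open>k\<close>; a supermartingale does not gain on such events in the mean.
\<close>
lemma expectation_upcrossings:
  fixes U :: "nat \<Rightarrow> 'w \<Rightarrow> real"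
  assumes U: "\<And>n. U n \<in> borel_measurable (F n)" and int: "\<And>n. integrable M (U n)"
    and nn: "\<And>n \<omega>. 0 \<le> U n \<omega>"
    and super: "\<And>n A. A \<in> sets (F n) \<Longrightarrow> (\<integral>\<omega>. indicator A \<omega> * U (Suc n) \<omega> \<partial>M) \<le> (\<integral>\<omega>. indicator A \<omega> * U n \<omega> \<partial>M)"
    and ab: "0 \<le> a" "a < b"
  shows "integrable M (\<lambda>\<omega>. real (upcrossings a b (\<lambda>k. U k \<omega>) n))"
    and "(\<integral>\<omega>. real (upcrossings a b (\<lambda>k. U k \<omega>) n) \<partial>M) \<le> a / (b - a)"
proof -
  define A where "A k = {\<omega>\<in>space M. holding a b (\<lambda>k. U k \<omega>) k}" for k
  have A: "A k \<in> sets (F k)" for k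
  proof -
    have "{\<omega>\<in>space (F k). holding a b (\<lambda>k. U k \<omega>) k} \<in> sets (F k)"
      using pred_holding[OF U] by (simp add: pred_def)
    moreover have "space (F k) = space M" using subalgebra_F[of k] by (simp add: subalgebra_def)
    ultimately show ?thesis by (simp add: A_def)
  qed
  have [measurable]: "A k \<in> sets M" for k using A sets_F by blast
  have [measurable]: "Measurable.pred M (\<lambda>\<omega>. holding a b (\<lambda>k. U k \<omega>) k)" for k
    using measurable_F[OF pred_holding[OF U]] .
  have meas: "(\<lambda>\<omega>. real (upcrossings a b (\<lambda>k. U k \<omega>) n)) \<in> borel_measurable M" for n
  proof (induction n)
    case (Suc n)
    then have [measurable]: "(\<lambda>\<omega>. real (upcrossings a b (\<lambda>k. U k \<omega>) n)) \<in> borel_measurable M" .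
    have "(\<lambda>\<omega>. real (upcrossings a b (\<lambda>k. U k \<omega>) n) + (if holding a b (\<lambda>k. U k \<omega>) n \<and> \<not> holding a b (\<lambda>k. U k \<omega>) (Suc n) then 1 else 0)) \<in> borel_measurable M"
      by measurable
    also have "(\<lambda>\<omega>. real (upcrossings a b (\<lambda>k. U k \<omega>) n) + (if holding a b (\<lambda>k. U k \<omega>) n \<and> \<not> holding a b (\<lambda>k. U k \<omega>) (Suc n) then 1 else 0))
        = (\<lambda>\<omega>. real (upcrossings a b (\<lambda>k. U k \<omega>) (Suc n)))"
      by (auto simp: fun_eq_iff)
    finally show ?case .
  qed simp
  show int_up: "integrable M (\<lambda>\<omega>. real (upcrossings a b (\<lambda>k. U k \<omega>) n))"
    by (rule integrable_const_bound[of _ "real n"]) (use meas upcrossings_le in auto)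
  have intA: "integrable M (\<lambda>\<omega>. indicator (A k) \<omega> * U j \<omega>)" for k j
    using integrable_mult_indicator[OF _ int[of j], of "A k"] by simp
  have gain_eq: "gain a b (\<lambda>k. U k \<omega>) n = (\<Sum>k<n. indicator (A k) \<omega> * U (Suc k) \<omega> - indicator (A k) \<omega> * U k \<omega>)"
    if "\<omega> \<in> space M" for \<omega>
    using that unfolding gain_def A_def by (intro sum.cong) (auto simp: indicator_def)
  have int_sum: "integrable M (\<lambda>\<omega>. \<Sum>k<n. indicator (A k) \<omega> * U (Suc k) \<omega> - indicator (A k) \<omega> * U k \<omega>)"
    by (intro Bochner_Integration.integrable_sum Bochner_Integration.integrable_diff intA)
  have "(b - a) * (\<integral>\<omega>. real (upcrossings a b (\<lambda>k. U k \<omega>) n) \<partial>M) - a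
      = (\<integral>\<omega>. (b - a) * real (upcrossings a b (\<lambda>k. U k \<omega>) n) - a \<partial>M)"
    using int_up by (simp add: prob_space)
  also have "\<dots> \<le> (\<integral>\<omega>. (\<Sum>k<n. indicator (A k) \<omega> * U (Suc k) \<omega> - indicator (A k) \<omega> * U k \<omega>) \<partial>M)"
  proof (rule integral_mono)
    fix \<omega> assume "\<omega> \<in> space M"
    then show "(b - a) * real (upcrossings a b (\<lambda>k. U k \<omega>) n) - a
        \<le> (\<Sum>k<n. indicator (A k) \<omega> * U (Suc k) \<omega> - indicator (A k) \<omega> * U k \<omega>)"
      using upcrossings_le_gain[OF ab, of "\<lambda>k. U k \<omega>" n] nn gain_eq by simp
  qed (use int_up int_sum in auto)
  also have "\<dots> = (\<Sum>k<n. (\<integral>\<omega>. indicator (A k) \<omega> * U (Suc k) \<omega> \<partial>M) - (\<integral>\<omega>. indicator (A k) \<omega> * U k \<omega> \<partial>M))"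
    using intA by (simp add: Bochner_Integration.integral_sum)
  also have "\<dots> \<le> 0" by (rule sum_nonpos) (use super[OF A] in auto)
  finally show "(\<integral>\<omega>. real (upcrossings a b (\<lambda>k. U k \<omega>) n) \<partial>M) \<le> a / (b - a)"
    using ab by (simp add: field_simps)
qed

text \<open>
  Almost surely all intervals with rational endpoints are crossed finitely often, and Fatou's
  lemma excludes the limit \<open>\<infinity>\<close>. The supermartingale property is stated through integrals over the
  events of \<open>F n\<close>, which is the form that the strategy uses.
\<close>
proposition nonneg_supermartingale_convergent:
  fixes U :: "nat \<Rightarrow> 'w \<Rightarrow> real"
  assumes U: "\<And>n. U n \<in> borel_measurable (F n)" and int: "\<And>n. integrable M (U n)"
    and nn: "\<And>n \<omega>. 0 \<le> U n \<omega>"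
    and super: "\<And>n A. A \<in> sets (F n) \<Longrightarrow> (\<integral>\<omega>. indicator A \<omega> * U (Suc n) \<omega> \<partial>M) \<le> (\<integral>\<omega>. indicator A \<omega> * U n \<omega> \<partial>M)"
  shows "AE \<omega> in M. convergent (\<lambda>n. U n \<omega>)"
proof -
  have [measurable]: "U n \<in> borel_measurable M" for n using int by auto
  have E_le: "(\<integral>\<omega>. U n \<omega> \<partial>M) \<le> (\<integral>\<omega>. U 0 \<omega> \<partial>M)" for n
  proof (induction n)
    case (Suc n)
    have "space M \<in> sets (F n)" using subalgebra_F[of n] by (metis sets.top subalgebra_def)
    moreover have "(\<integral>\<omega>. indicator (space M) \<omega> * U m \<omega> \<partial>M) = (\<integral>\<omega>. U m \<omega> \<partial>M)" for m
      by (intro Bochner_Integration.integral_cong) auto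
    ultimately have "(\<integral>\<omega>. U (Suc n) \<omega> \<partial>M) \<le> (\<integral>\<omega>. U n \<omega> \<partial>M)"
      using super[of "space M" n] by simp
    then show ?case using Suc by linarith
  qed simp
  have "(\<integral>\<^sup>+\<omega>. liminf (\<lambda>n. ennreal (U n \<omega>)) \<partial>M) \<le> liminf (\<lambda>n. \<integral>\<^sup>+\<omega>. ennreal (U n \<omega>) \<partial>M)"
    by (rule nn_integral_liminf) simp
  also have "\<dots> \<le> ennreal (\<integral>\<omega>. U 0 \<omega> \<partial>M)"
    by (rule Liminf_le) (simp_all add: nn_integral_eq_integral[OF int] nn ennreal_leI E_le)
  finally have "(\<integral>\<^sup>+\<omega>. liminf (\<lambda>n. ennreal (U n \<omega>)) \<partial>M) \<noteq> \<infinity>" by (auto simp: top_unique)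
  then have "AE \<omega> in M. liminf (\<lambda>n. ennreal (U n \<omega>)) \<noteq> \<infinity>" by (intro nn_integral_PInf_AE) auto
  then have freq: "AE \<omega> in M. \<exists>B. \<exists>\<^sub>F n in sequentially. U n \<omega> \<le> B"
  proof eventually_elim
    case (elim \<omega>)
    show ?case
    proof (rule ccontr)
      assume "\<not> ?thesis"
      then have ev: "\<And>B. \<forall>\<^sub>F n in sequentially. B < U n \<omega>" by (simp add: frequently_def not_le)
      have "of_nat B \<le> liminf (\<lambda>n. ennreal (U n \<omega>))" for B
      proof (rule Liminf_bounded)
        show "\<forall>\<^sub>F n in sequentially. of_nat B \<le> ennreal (U n \<omega>)"
          using ev[of "real B"] by eventually_elim (simp add: ennreal_of_nat_eq_real_of_nat ennreal_leI)
      qed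
      then have "liminf (\<lambda>n. ennreal (U n \<omega>)) = \<infinity>"
        by (metis ennreal_Ex_less_of_nat infinity_ennreal_def linorder_not_less top.not_eq_extremum)
      then show False using elim by simp
    qed
  qed
  have up: "AE \<omega> in M. \<exists>K. \<forall>n. upcrossings a b (\<lambda>k. U k \<omega>) n \<le> K" if "0 \<le> a" "a < b" for a b
  proof -
    have "AE \<omega> in M. \<exists>K. \<forall>n. real (upcrossings a b (\<lambda>k. U k \<omega>) n) \<le> K"
      by (rule AE_bounded_of_monotone_expectation)
         (use expectation_upcrossings[OF U int nn super that] in auto)
    then show ?thesis
    proof eventually_elim
      case (elim \<omega>)
      then show ?case by (metis nat_floor_neg le_nat_floor)
    qed
  qed
  have "AE \<omega> in M. \<forall>(a, b) \<in> (\<rat> \<times> \<rat>) \<inter> {(a, b). 0 \<le> a \<and> a < b}. \<exists>K. \<forall>n. upcrossings a b (\<lambda>k. U k \<omega>) n \<le> K"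
    by (rule AE_ball_countable') (use up countable_rat in \<open>auto intro: countable_Int1\<close>)
  with freq show ?thesis
  proof eventually_elim
    case (elim \<omega>)
    then obtain B where "\<exists>\<^sub>F n in sequentially. U n \<omega> \<le> B" by blast
    then show ?case
    proof (rule convergent_of_finite_upcrossings[OF nn])
      fix a b :: real assume "a \<in> \<rat>" "b \<in> \<rat>" "0 \<le> a" "a < b"
      then show "\<exists>K. \<forall>n. upcrossings a b (\<lambda>k. U k \<omega>) n \<le> K"
        using elim(2) by (auto dest!: bspec[of _ _ "(a, b)"])
    qed
  qed
qed

section \<open>Almost supermartingales\<close>

text \<open>
  The process \<open>\<alpha> n + (\<Sum>k<n. \<theta> k) - (\<Sum>k<n. \<epsilon> k)\<close> is a supermartingale that may be unbounded below.
  Adding a constant \<open>c\<close>, and killing the process as soon as the sum of the \<open>\<epsilon> k\<close> exceeds \<open>c\<close>,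
  makes it nonnegative; setting a nonnegative process to \<open>0\<close> preserves the supermartingale
  property, since the sum over \<open>k < n + 1\<close> is already known at time \<open>n\<close>. On paths where the total
  error is at most \<open>c\<close> nothing is killed, and these paths exhaust the space as \<open>c\<close> grows.
\<close>
proposition Robbins_Siegmund:
  fixes \<alpha> \<theta> \<epsilon> :: "nat \<Rightarrow> 'w \<Rightarrow> real"
  assumes \<alpha>: "\<And>n. \<alpha> n \<in> borel_measurable (F n)" and int_\<alpha>: "\<And>n. integrable M (\<alpha> n)"
    and nn_\<alpha>: "\<And>n \<omega>. 0 \<le> \<alpha> n \<omega>"
    and \<theta>: "\<And>n. \<theta> n \<in> borel_measurable (F n)" and int_\<theta>: "\<And>n. integrable M (\<theta> n)"
    and nn_\<theta>: "\<And>n \<omega>. 0 \<le> \<theta> n \<omega>"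
    and \<epsilon>: "\<And>n. \<epsilon> n \<in> borel_measurable (F n)" and int_\<epsilon>: "\<And>n. integrable M (\<epsilon> n)"
    and nn_\<epsilon>: "\<And>n \<omega>. 0 \<le> \<epsilon> n \<omega>"
    and super: "\<And>n. AE \<omega> in M. real_cond_exp M (F n) (\<alpha> (Suc n)) \<omega> \<le> \<alpha> n \<omega> - \<theta> n \<omega> + \<epsilon> n \<omega>"
    and summ: "AE \<omega> in M. summable (\<lambda>n. \<epsilon> n \<omega>)"
  shows "AE \<omega> in M. convergent (\<lambda>n. \<alpha> n \<omega>) \<and> summable (\<lambda>n. \<theta> n \<omega>)"
proof -
  define S where "S n \<omega> = (\<Sum>k<n. \<epsilon> k \<omega>)" for n \<omega>
  define T where "T n \<omega> = (\<Sum>k<n. \<theta> k \<omega>)" for n \<omega>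
  have S_mono: "S n \<omega> \<le> S (Suc n) \<omega>" for n \<omega> by (simp add: S_def nn_\<epsilon>)
  have T_nn: "0 \<le> T n \<omega>" for n \<omega> by (simp add: T_def sum_nonneg nn_\<theta>)
  have S_meas: "S n \<in> borel_measurable (F m)" if "n \<le> Suc m" for n m
    unfolding S_def by (intro borel_measurable_sum measurable_F_mono[OF \<epsilon>]) (use that in auto)
  have T_meas: "T n \<in> borel_measurable (F m)" if "n \<le> Suc m" for n m
    unfolding T_def by (intro borel_measurable_sum measurable_F_mono[OF \<theta>]) (use that in auto)
  have int_S: "integrable M (S n)" for n unfolding S_def by (intro Bochner_Integration.integrable_sum int_\<epsilon>)
  have int_T: "integrable M (T n)" for n unfolding T_def by (intro Bochner_Integration.integrable_sum int_\<theta>)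
  have set_super: "(\<integral>\<omega>. indicator A \<omega> * \<alpha> (Suc n) \<omega> \<partial>M) \<le> (\<integral>\<omega>. indicator A \<omega> * (\<alpha> n \<omega> - \<theta> n \<omega> + \<epsilon> n \<omega>) \<partial>M)"
    if A: "A \<in> sets (F n)" for A n
  proof -
    interpret S: sigma_finite_subalgebra M "F n" by (rule sigma_finite_subalgebra_F)
    have AM: "A \<in> sets M" using A by (rule sets_F)
    have I: "integrable M (\<lambda>\<omega>. indicator A \<omega> * f \<omega>)" if "integrable M f" for f :: "'w \<Rightarrow> real"
      using integrable_mult_indicator[OF AM that] by simp
    have "(\<integral>\<omega>. indicator A \<omega> * \<alpha> (Suc n) \<omega> \<partial>M) = (\<integral>\<omega>. indicator A \<omega> * real_cond_exp M (F n) (\<alpha> (Suc n)) \<omega> \<partial>M)"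
      using S.real_cond_exp_intA[OF int_\<alpha> A] by (simp add: set_lebesgue_integral_def)
    also have "\<dots> \<le> (\<integral>\<omega>. indicator A \<omega> * (\<alpha> n \<omega> - \<theta> n \<omega> + \<epsilon> n \<omega>) \<partial>M)"
    proof (rule integral_mono_AE)
      show "AE \<omega> in M. indicator A \<omega> * real_cond_exp M (F n) (\<alpha> (Suc n)) \<omega> \<le> indicator A \<omega> * (\<alpha> n \<omega> - \<theta> n \<omega> + \<epsilon> n \<omega>)"
        using super[of n] by eventually_elim (auto intro!: mult_left_mono)
    qed (auto intro!: I S.real_cond_exp_int int_\<alpha> int_\<theta> int_\<epsilon>)
    finally show ?thesis .
  qed
  define U where "U c n \<omega> = of_bool (S n \<omega> \<le> c) * (\<alpha> n \<omega> + T n \<omega> + c - S n \<omega>)" for c n \<omega>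
  have conv: "AE \<omega> in M. convergent (\<lambda>n. U c n \<omega>)" for c
  proof (rule nonneg_supermartingale_convergent)
    show U_nn: "0 \<le> U c n \<omega>" for n \<omega> using T_nn[of n \<omega>] nn_\<alpha>[of n \<omega>] by (simp add: U_def)
    show U_meas: "U c n \<in> borel_measurable (F n)" for n
    proof -
      have [measurable]: "S n \<in> borel_measurable (F n)" "T n \<in> borel_measurable (F n)" "\<alpha> n \<in> borel_measurable (F n)"
        using S_meas T_meas \<alpha> by auto
      show ?thesis unfolding U_def of_bool_def by measurable
    qed
    have B_meas: "{\<omega>\<in>space M. S n \<omega> \<le> c} \<in> sets (F m)" if "n \<le> Suc m" for n m
    proof -
      have [measurable]: "S n \<in> borel_measurable (F m)" using S_meas that .
      have "{\<omega>\<in>space (F m). S n \<omega> \<le> c} \<in> sets (F m)" by measurable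
      moreover have "space (F m) = space M" using subalgebra_F[of m] by (simp add: subalgebra_def)
      ultimately show ?thesis by simp
    qed
    have int_body: "integrable M (\<lambda>\<omega>. \<alpha> n \<omega> + T n \<omega> + c - S n \<omega>)" for n
      by (intro Bochner_Integration.integrable_add Bochner_Integration.integrable_diff int_\<alpha> int_S int_T) simp
    have U_eq: "U c n \<omega> = indicator {\<omega>\<in>space M. S n \<omega> \<le> c} \<omega> * (\<alpha> n \<omega> + T n \<omega> + c - S n \<omega>)" if "\<omega> \<in> space M" for n \<omega>
      using that by (simp add: U_def indicator_def)
    show int_U: "integrable M (U c n)" for n
    proof -
      have "integrable M (\<lambda>\<omega>. indicator {\<omega>\<in>space M. S n \<omega> \<le> c} \<omega> * (\<alpha> n \<omega> + T n \<omega> + c - S n \<omega>))"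
        using integrable_mult_indicator[OF sets_F[OF B_meas[OF le_SucI[OF order_refl]]] int_body] by simp
      then show ?thesis using U_eq by (simp cong: Bochner_Integration.integrable_cong)
    qed
    fix n A assume A: "A \<in> sets (F n)"
    define B where "B = A \<inter> {\<omega>\<in>space M. S (Suc n) \<omega> \<le> c}"
    have B: "B \<in> sets (F n)" using A B_meas[of "Suc n" n] by (auto simp: B_def)
    have BM: "B \<in> sets M" "A \<in> sets M" using A B sets_F by auto
    have I: "integrable M (\<lambda>\<omega>. indicator B \<omega> * f \<omega>)" "integrable M (\<lambda>\<omega>. indicator A \<omega> * f \<omega>)" if "integrable M f" for f :: "'w \<Rightarrow> real"
      using integrable_mult_indicator[OF BM(1) that] integrable_mult_indicator[OF BM(2) that] by simp_all
    let ?R = "\<lambda>\<omega>. T (Suc n) \<omega> + c - S (Suc n) \<omega>"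
    have int_R: "integrable M ?R"
      by (intro Bochner_Integration.integrable_add Bochner_Integration.integrable_diff int_S int_T) simp
    have "(\<integral>\<omega>. indicator A \<omega> * U c (Suc n) \<omega> \<partial>M) = (\<integral>\<omega>. indicator B \<omega> * \<alpha> (Suc n) \<omega> + indicator B \<omega> * ?R \<omega> \<partial>M)"
      by (intro Bochner_Integration.integral_cong) (auto simp: B_def U_def indicator_def)
    also have "\<dots> = (\<integral>\<omega>. indicator B \<omega> * \<alpha> (Suc n) \<omega> \<partial>M) + (\<integral>\<omega>. indicator B \<omega> * ?R \<omega> \<partial>M)"
      by (intro Bochner_Integration.integral_add I int_\<alpha> int_R)
    also have "\<dots> \<le> (\<integral>\<omega>. indicator B \<omega> * (\<alpha> n \<omega> - \<theta> n \<omega> + \<epsilon> n \<omega>) \<partial>M) + (\<integral>\<omega>. indicator B \<omega> * ?R \<omega> \<partial>M)"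
      using set_super[OF B] by simp
    also have "\<dots> = (\<integral>\<omega>. indicator B \<omega> * (\<alpha> n \<omega> - \<theta> n \<omega> + \<epsilon> n \<omega>) + indicator B \<omega> * ?R \<omega> \<partial>M)"
      by (intro Bochner_Integration.integral_add[symmetric] I int_R Bochner_Integration.integrable_add Bochner_Integration.integrable_diff int_\<alpha> int_\<theta> int_\<epsilon>)
    also have "\<dots> \<le> (\<integral>\<omega>. indicator A \<omega> * U c n \<omega> \<partial>M)"
    proof (rule integral_mono)
      fix \<omega> assume "\<omega> \<in> space M"
      show "indicator B \<omega> * (\<alpha> n \<omega> - \<theta> n \<omega> + \<epsilon> n \<omega>) + indicator B \<omega> * ?R \<omega> \<le> indicator A \<omega> * U c n \<omega>"
      proof (cases "\<omega> \<in> B")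
        case True
        then have "\<omega> \<in> A" "S n \<omega> \<le> c" using S_mono[of n \<omega>] by (auto simp: B_def)
        then show ?thesis using True by (simp add: U_def S_def T_def)
      qed (simp add: U_nn)
    qed (auto intro!: I int_U Bochner_Integration.integrable_add int_R int_\<alpha> int_\<theta> int_\<epsilon>)
    finally show "(\<integral>\<omega>. indicator A \<omega> * U c (Suc n) \<omega> \<partial>M) \<le> (\<integral>\<omega>. indicator A \<omega> * U c n \<omega> \<partial>M)" .
  qed
  have "AE \<omega> in M. \<forall>c. convergent (\<lambda>n. U (real c) n \<omega>)"
    using conv by (simp add: AE_all_countable)
  with summ show ?thesis
  proof eventually_elim
    case (elim \<omega>)
    obtain c :: nat where c: "suminf (\<lambda>n. \<epsilon> n \<omega>) \<le> real c" using real_arch_simple by blast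
    have "S n \<omega> \<le> c" for n
      using sum_le_suminf[OF elim(1), of "{..<n}"] c nn_\<epsilon> by (simp add: S_def)
    then have U_eq: "U (real c) n \<omega> = \<alpha> n \<omega> + T n \<omega> + c - S n \<omega>" for n by (simp add: U_def)
    have S_conv: "convergent (\<lambda>n. S n \<omega>)"
      using elim(1) by (simp add: S_def summable_iff_convergent)
    have "convergent (\<lambda>n. U (real c) n \<omega> + S n \<omega> - c)"
      using elim(2) S_conv by (intro convergent_diff convergent_add convergent_const) auto
    then have sum_conv: "convergent (\<lambda>n. \<alpha> n \<omega> + T n \<omega>)" by (simp add: U_eq)
    then obtain B where B: "\<And>n. \<bar>\<alpha> n \<omega> + T n \<omega>\<bar> \<le> B"
      using convergent_imp_Bseq[OF sum_conv] by (auto simp: Bseq_def)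
    have "summable (\<lambda>n. \<theta> n \<omega>)"
    proof (rule summableI_nonneg_bounded)
      show "(\<Sum>k<n. \<theta> k \<omega>) \<le> B" for n using B[of n] nn_\<alpha>[of n \<omega>] by (simp add: T_def)
    qed (rule nn_\<theta>)
    moreover from this have "convergent (\<lambda>n. T n \<omega>)" by (simp add: T_def summable_iff_convergent)
    with sum_conv have "convergent (\<lambda>n. (\<alpha> n \<omega> + T n \<omega>) - T n \<omega>)" by (rule convergent_diff)
    then have "convergent (\<lambda>n. \<alpha> n \<omega>)" by simp
    ultimately show ?case by blast
  qed
qed

text \<open>
  An error bound \<open>D n\<close> that is not adapted is replaced by the smallest error \<open>\<epsilon> n\<close> for which the
  inequality holds. This one is adapted and integrable, and it is at most \<open>D n\<close>.
\<close>
lemma Robbins_Siegmund_dominated: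
  fixes \<alpha> \<theta> :: "nat \<Rightarrow> 'w \<Rightarrow> real"
  assumes \<alpha>: "\<And>n. \<alpha> n \<in> borel_measurable (F n)" and int_\<alpha>: "\<And>n. integrable M (\<alpha> n)"
    and nn_\<alpha>: "\<And>n \<omega>. 0 \<le> \<alpha> n \<omega>"
    and \<theta>: "\<And>n. \<theta> n \<in> borel_measurable (F n)" and int_\<theta>: "\<And>n. integrable M (\<theta> n)"
    and nn_\<theta>: "\<And>n. AE \<omega> in M. 0 \<le> \<theta> n \<omega>"
    and super: "\<And>n. AE \<omega> in M. real_cond_exp M (F n) (\<alpha> (Suc n)) \<omega> \<le> \<alpha> n \<omega> - \<theta> n \<omega> + D n \<omega>"
    and nn_D: "\<And>n. AE \<omega> in M. 0 \<le> D n \<omega>"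
    and summ: "AE \<omega> in M. summable (\<lambda>n. D n \<omega>)"
  shows "AE \<omega> in M. convergent (\<lambda>n. \<alpha> n \<omega>) \<and> summable (\<lambda>n. \<theta> n \<omega>)"
proof -
  \<comment> \<open>Positive parts replace almost sure nonnegativity by nonnegativity.\<close>
  define \<theta>' where "\<theta>' n \<omega> = max 0 (\<theta> n \<omega>)" for n \<omega>
  define \<epsilon> where "\<epsilon> n \<omega> = max 0 (real_cond_exp M (F n) (\<alpha> (Suc n)) \<omega> - \<alpha> n \<omega> + \<theta>' n \<omega>)" for n \<omega>
  have \<theta>'_eq: "AE \<omega> in M. \<forall>n. \<theta>' n \<omega> = \<theta> n \<omega>"
    using nn_\<theta> by (auto simp: AE_all_countable \<theta>'_def max_def elim: eventually_mono)
  have [measurable]: "\<alpha> n \<in> borel_measurable (F n)" "\<theta> n \<in> borel_measurable (F n)" for n by (fact \<alpha> \<theta>)+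
  have meas: "\<theta>' n \<in> borel_measurable (F n)" "\<epsilon> n \<in> borel_measurable (F n)" for n
    unfolding \<theta>'_def \<epsilon>_def by measurable
  have int_\<theta>': "integrable M (\<theta>' n)" for n unfolding \<theta>'_def using int_\<theta> by auto
  have int_\<epsilon>: "integrable M (\<epsilon> n)" for n
    unfolding \<epsilon>_def
    by (intro Bochner_Integration.integrable_max Bochner_Integration.integrable_add Bochner_Integration.integrable_diff
        int_\<alpha> int_\<theta>' sigma_finite_subalgebra.real_cond_exp_int[OF sigma_finite_subalgebra_F]) simp
  have \<epsilon>_le: "AE \<omega> in M. \<forall>n. \<epsilon> n \<omega> \<le> D n \<omega>"
    unfolding AE_all_countable
  proof
    fix n
    show "AE \<omega> in M. \<epsilon> n \<omega> \<le> D n \<omega>"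
      using super[of n] nn_D[of n] nn_\<theta>[of n] by eventually_elim (auto simp: \<epsilon>_def \<theta>'_def)
  qed
  have "AE \<omega> in M. convergent (\<lambda>n. \<alpha> n \<omega>) \<and> summable (\<lambda>n. \<theta>' n \<omega>)"
  proof (rule Robbins_Siegmund[OF \<alpha> int_\<alpha> nn_\<alpha> meas(1) int_\<theta>' _ meas(2) int_\<epsilon>])
    show "AE \<omega> in M. real_cond_exp M (F n) (\<alpha> (Suc n)) \<omega> \<le> \<alpha> n \<omega> - \<theta>' n \<omega> + \<epsilon> n \<omega>" for n
      by (rule AE_I2) (simp add: \<epsilon>_def max_def)
    show "AE \<omega> in M. summable (\<lambda>n. \<epsilon> n \<omega>)"
      using summ \<epsilon>_le
    proof eventually_elim
      case (elim \<omega>)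
      have "norm (\<epsilon> n \<omega>) \<le> D n \<omega>" for n using elim(2) by (simp add: \<epsilon>_def)
      then show ?case using elim(1) by (intro summable_comparison_test[of "\<lambda>n. \<epsilon> n \<omega>" "\<lambda>n. D n \<omega>"]) blast+
    qed
  qed (simp_all add: \<theta>'_def \<epsilon>_def)
  with \<theta>'_eq show ?thesis by eventually_elim simp
qed

end

section \<open>The iteration\<close>

text \<open>
  The standing assumptions on the iteration. The half-space of all \<open>z\<close> with
  \<open>(z + d n - x n) \<bullet> d n \<le> 0\<close> is the cut that separates \<open>x n\<close> from \<open>Z\<close>, in the
  conditional mean and up to the error \<open>\<delta> n\<close>.
\<close>
locale stochastic_Fejer = prob_space M + complete_measure M
  for M :: "'w measure" +
  fixes Z :: "'h :: {real_inner, banach, second_countable_topology} set"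
    and x d :: "nat \<Rightarrow> 'w \<Rightarrow> 'h"
    and lam :: "nat \<Rightarrow> 'w \<Rightarrow> real"
    and \<delta> :: "nat \<Rightarrow> 'w \<Rightarrow> 'h \<Rightarrow> real"
  assumes Z_nonempty: "Z \<noteq> {}"
    and x_0: "x 0 \<in> Lp_space M M 2 UNIV"
    and lam: "lam n \<in> Linf_space M M {0<..}"
    and d: "d n \<in> Lp_space M M 2 UNIV"
    and \<delta>: "\<delta> n \<in> integrand_class M"
    and decrease_nonneg: "AE \<omega> in M.
          real_cond_exp M (generated_algebra M x n) (\<lambda>\<omega>. lam n \<omega> * (2 - lam n \<omega>) * (norm (d n \<omega>))\<^sup>2) \<omega> \<ge> 0"
    and cut: "z \<in> Z \<Longrightarrow> AE \<omega> in M.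
          real_cond_exp M (generated_algebra M x n) (\<lambda>\<omega>. lam n \<omega> * ((z + d n \<omega> - x n \<omega>) \<bullet> d n \<omega>)) \<omega> \<le> \<delta> n \<omega> z / 2"
    and step: "AE \<omega> in M. x (Suc n) \<omega> = x n \<omega> - lam n \<omega> *\<^sub>R d n \<omega>"
begin

abbreviation \<X> :: "nat \<Rightarrow> 'w measure" where "\<X> n \<equiv> generated_algebra M x n"

definition decrease :: "nat \<Rightarrow> 'w \<Rightarrow> real" where
  "decrease n \<omega> = lam n \<omega> * (2 - lam n \<omega>) * (norm (d n \<omega>))\<^sup>2"

lemma lam_measurable[measurable]: "lam n \<in> borel_measurable M"
  using lam[of n] by (simp add: Linf_space_def)

lemma lam_bounded: obtains C where "AE \<omega> in M. \<bar>lam n \<omega>\<bar> \<le> C"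
  using lam[of n] by (auto simp: Linf_space_def)

lemma d_measurable[measurable]: "d n \<in> borel_measurable M"
  and d_integrable: "integrable M (\<lambda>\<omega>. (norm (d n \<omega>))\<^sup>2)"
  using d[of n] by (simp_all add: Lp_space_2_iff)

lemma lam_d_integrable: "integrable M (\<lambda>\<omega>. (norm (lam n \<omega> *\<^sub>R d n \<omega>))\<^sup>2)"
proof -
  obtain C where C: "AE \<omega> in M. \<bar>lam n \<omega>\<bar> \<le> C" by (rule lam_bounded)
  have "integrable M (\<lambda>\<omega>. (lam n \<omega>)\<^sup>2 * (norm (d n \<omega>))\<^sup>2)"
  proof (rule integrable_mult_ess_bounded[OF d_integrable])
    show "AE \<omega> in M. \<bar>(lam n \<omega>)\<^sup>2\<bar> \<le> C\<^sup>2"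
      using C by eventually_elim (metis abs_ge_zero abs_power2 power2_abs power_mono)
  qed simp
  then show ?thesis by (simp add: power_mult_distrib)
qed

text \<open>
  The recursion holds only almost surely; completeness of the measure is what makes
  \<open>x (Suc n)\<close> measurable.
\<close>
proposition x_in_L2: "x n \<in> Lp_space M M 2 UNIV"
proof (induction n)
  case 0
  show ?case by (rule x_0)
next
  case (Suc n)
  then have [measurable]: "x n \<in> borel_measurable M" and int: "integrable M (\<lambda>\<omega>. (norm (x n \<omega>))\<^sup>2)"
    by (simp_all add: Lp_space_2_iff)
  have meas[measurable]: "x (Suc n) \<in> borel_measurable M" by (rule borel_measurable_AE_eq[OF _ step]) measurable
  have int': "integrable M (\<lambda>\<omega>. (norm (x n \<omega> - lam n \<omega> *\<^sub>R d n \<omega>))\<^sup>2)"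
    by (rule integrable_norm_power2_diff) (use int lam_d_integrable in auto)
  have ae: "AE \<omega> in M. (norm (x n \<omega> - lam n \<omega> *\<^sub>R d n \<omega>))\<^sup>2 = (norm (x (Suc n) \<omega>))\<^sup>2"
    using step[of n] by eventually_elim simp
  have "integrable M (\<lambda>\<omega>. (norm (x (Suc n) \<omega>))\<^sup>2)"
    by (rule integrable_cong_AE_imp[OF int' _ ae]) simp
  then show ?case using meas by (simp add: Lp_space_2_iff)
qed

lemma x_measurable[measurable]: "x n \<in> borel_measurable M"
  and x_integrable: "integrable M (\<lambda>\<omega>. (norm (x n \<omega>))\<^sup>2)"
  using x_in_L2[of n] by (simp_all add: Lp_space_2_iff)

lemma space_\<X>: "space (\<X> n) = space M"
  unfolding generated_algebra_def by (rule space_measure_of) blast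

lemma sets_\<X>: "sets (\<X> n) = sigma_sets (space M) {x k -` A \<inter> space M | k A. k \<le> n \<and> A \<in> sets borel}"
  unfolding generated_algebra_def by (rule sets_measure_of) blast

sublocale filtered_prob_space M \<X>
proof unfold_locales
  fix n
  have "{x k -` A \<inter> space M | k A. k \<le> n \<and> A \<in> sets borel} \<subseteq> sets M"
    using measurable_sets[OF x_measurable] by blast
  then show "subalgebra M (\<X> n)"
    unfolding subalgebra_def space_\<X> sets_\<X> using sets.sigma_sets_subset by blast
  show "sets (\<X> n) \<subseteq> sets (\<X> (Suc n))"
    unfolding sets_\<X> by (rule sigma_sets_mono') (auto intro: le_SucI)
qed

lemma x_measurable_\<X>[measurable]: "x n \<in> borel_measurable (\<X> n)"
proof (rule measurableI)
  fix A :: "'h set" assume "A \<in> sets borel"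
  then show "x n -` A \<inter> space (\<X> n) \<in> sets (\<X> n)"
    unfolding sets_\<X> space_\<X> by (intro sigma_sets.Basic) blast
qed simp

lemma decrease_integrable: "integrable M (decrease n)"
proof -
  obtain C where C: "AE \<omega> in M. \<bar>lam n \<omega>\<bar> \<le> C" by (rule lam_bounded)
  have "AE \<omega> in M. \<bar>2 - lam n \<omega>\<bar> \<le> 2 + C" using C by eventually_elim auto
  from integrable_mult_ess_bounded[OF integrable_mult_ess_bounded[OF d_integrable _ this] _ C]
  show ?thesis by (simp add: decrease_def[abs_def] mult.assoc)
qed

lemma expectation_decrease_nonneg: "0 \<le> expectation (decrease n)"
proof -
  interpret S: sigma_finite_subalgebra M "\<X> n" by (rule sigma_finite_subalgebra_F)
  have "expectation (decrease n) = expectation (real_cond_exp M (\<X> n) (decrease n))"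
    by (rule S.real_cond_exp_int(2)[symmetric, OF decrease_integrable])
  also have "\<dots> \<ge> 0"
    using decrease_nonneg[of n] by (intro integral_nonneg_AE) (simp add: decrease_def[abs_def])
  finally show ?thesis .
qed

lemma \<delta>_nonneg: "\<omega> \<in> space M \<Longrightarrow> 0 \<le> \<delta> n \<omega> z"
  using \<delta>[of n] by (simp add: integrand_class_def)

lemma \<delta>_continuous: "AE \<omega> in M. continuous_on UNIV (\<delta> n \<omega>)"
  using \<delta>[of n] by (simp add: integrand_class_def)

lemma \<delta>_integrable:
  assumes "z \<in> Lp_space M M 2 UNIV"
  shows "integrable M (\<lambda>\<omega>. \<delta> n \<omega> (z \<omega>))"
proof (rule integrableI_nonneg)
  show "(\<lambda>\<omega>. \<delta> n \<omega> (z \<omega>)) \<in> borel_measurable M"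
  proof (rule borel_measurable_Caratheodory[OF \<delta>_continuous])
    show "(\<lambda>\<omega>. \<delta> n \<omega> v) \<in> borel_measurable M" for v using \<delta>[of n] by (simp add: integrand_class_def)
    show "z \<in> borel_measurable M" using assms by (simp add: Lp_space_2_iff)
  qed
  show "(\<integral>\<^sup>+\<omega>. ennreal (\<delta> n \<omega> (z \<omega>)) \<partial>M) < \<infinity>"
    using \<delta>[of n] assms by (simp add: integrand_class_def)
qed (rule AE_I2, rule \<delta>_nonneg)

lemma const_in_Lp: "z \<in> S \<Longrightarrow> (\<lambda>_. z) \<in> Lp_space M X 2 S"
  by (simp add: Lp_space_2_iff)

lemma Lp_\<X>_imp_Lp: "z \<in> Lp_space M (\<X> n) 2 S \<Longrightarrow> z \<in> Lp_space M M 2 UNIV"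
  by (auto simp: Lp_space_2_iff intro: measurable_F)

lemma cut_integrable:
  assumes z: "z \<in> Lp_space M M 2 UNIV"
  shows "integrable M (\<lambda>\<omega>. lam n \<omega> * ((z \<omega> + d n \<omega> - x n \<omega>) \<bullet> d n \<omega>))"
proof -
  obtain C where C: "AE \<omega> in M. \<bar>lam n \<omega>\<bar> \<le> C" by (rule lam_bounded)
  have [measurable]: "z \<in> borel_measurable M" and int_z: "integrable M (\<lambda>\<omega>. (norm (z \<omega>))\<^sup>2)"
    using z by (simp_all add: Lp_space_2_iff)
  have "integrable M (\<lambda>\<omega>. (norm (z \<omega> - (x n \<omega> - d n \<omega>)))\<^sup>2)"
    by (intro integrable_norm_power2_diff int_z x_integrable d_integrable) simp_all
  then have "integrable M (\<lambda>\<omega>. (norm (z \<omega> + d n \<omega> - x n \<omega>))\<^sup>2)" by (simp add: algebra_simps)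
  then have "integrable M (\<lambda>\<omega>. (z \<omega> + d n \<omega> - x n \<omega>) \<bullet> d n \<omega>)"
    by (intro integrable_inner d_integrable) simp_all
  then show ?thesis by (rule integrable_mult_ess_bounded[OF _ _ C]) simp
qed

text \<open>
  For \<open>v = z\<close> the integrand of the cut splits as \<open>G + v \<bullet> W\<close> with \<open>W = lam n *\<^sub>R d n\<close>, which is the
  affine dependence needed to substitute a random point.
\<close>
lemma cut_random_point:
  assumes z: "z \<in> Lp_space M (\<X> n) 2 Z"
  shows "AE \<omega> in M. real_cond_exp M (\<X> n) (\<lambda>\<omega>. lam n \<omega> * ((z \<omega> + d n \<omega> - x n \<omega>) \<bullet> d n \<omega>)) \<omega> \<le> \<delta> n \<omega> (z \<omega>) / 2"
proof -
  interpret S: sigma_finite_subalgebra M "\<X> n" by (rule sigma_finite_subalgebra_F)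
  define G where "G \<omega> = lam n \<omega> * ((0 + d n \<omega> - x n \<omega>) \<bullet> d n \<omega>)" for \<omega>
  define W where "W \<omega> = lam n \<omega> *\<^sub>R d n \<omega>" for \<omega>
  have eq: "lam n \<omega> * ((v + d n \<omega> - x n \<omega>) \<bullet> d n \<omega>) = G \<omega> + v \<bullet> W \<omega>" for v \<omega>
    by (simp add: G_def W_def inner_simps algebra_simps)
  have [measurable]: "z \<in> borel_measurable M" and int_z: "integrable M (\<lambda>\<omega>. (norm (z \<omega>))\<^sup>2)"
    using Lp_\<X>_imp_Lp[OF z] by (simp_all add: Lp_space_2_iff)
  have [measurable]: "W \<in> borel_measurable M" unfolding W_def by measurable
  have int_W: "integrable M (\<lambda>\<omega>. (norm (W \<omega>))\<^sup>2)" unfolding W_def by (rule lam_d_integrable)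
  have "AE \<omega> in M. real_cond_exp M (\<X> n) (\<lambda>\<omega>. G \<omega> + z \<omega> \<bullet> W \<omega>) \<omega> \<le> \<delta> n \<omega> (z \<omega>) / 2"
  proof (rule S.real_cond_exp_affine_le_random_point)
    show "integrable M G" unfolding G_def by (rule cut_integrable) (simp add: const_in_Lp)
    show "integrable M (\<lambda>\<omega>. norm (W \<omega>))"
      by (rule integrable_norm[OF integrable_of_integrable_power2[OF finite_measure_axioms _ int_W]]) simp
    show "integrable M (\<lambda>\<omega>. norm (z \<omega>) * norm (W \<omega>))"
      by (rule integrable_norm_mult[OF _ _ int_z int_W]) simp_all
    show "AE \<omega> in M. continuous_on UNIV (\<lambda>v. \<delta> n \<omega> v / 2)"
      using \<delta>_continuous[of n] by eventually_elim (intro continuous_intros, auto)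
    show "AE \<omega> in M. real_cond_exp M (\<X> n) (\<lambda>\<omega>. G \<omega> + v \<bullet> W \<omega>) \<omega> \<le> \<delta> n \<omega> v / 2" if "v \<in> Z" for v
      using cut[OF that, of n] by (simp add: eq)
  qed (use z Z_nonempty in \<open>auto simp: Lp_space_2_iff\<close>)
  then show ?thesis by (simp add: eq)
qed

text \<open>
  The square expands as
  \<open>\<parallel>x (Suc n) - z\<parallel>\<^sup>2 = \<parallel>x n - z\<parallel>\<^sup>2 - decrease n + 2 * lam n * ((z + d n - x n) \<bullet> d n)\<close>, and the
  last term is controlled by the cut.
\<close>
proposition cond_exp_dist_random_point:
  assumes z: "z \<in> Lp_space M (\<X> n) 2 Z"
  shows "AE \<omega> in M. real_cond_exp M (\<X> n) (\<lambda>\<omega>. (norm (x (Suc n) \<omega> - z \<omega>))\<^sup>2) \<omega>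
    \<le> (norm (x n \<omega> - z \<omega>))\<^sup>2 - real_cond_exp M (\<X> n) (decrease n) \<omega> + \<delta> n \<omega> (z \<omega>)"
proof -
  interpret S: sigma_finite_subalgebra M "\<X> n" by (rule sigma_finite_subalgebra_F)
  have zM: "z \<in> Lp_space M M 2 UNIV" by (rule Lp_\<X>_imp_Lp[OF z])
  then have [measurable]: "z \<in> borel_measurable M" and int_z: "integrable M (\<lambda>\<omega>. (norm (z \<omega>))\<^sup>2)"
    by (simp_all add: Lp_space_2_iff)
  have [measurable]: "z \<in> borel_measurable (\<X> n)" using z by (simp add: Lp_space_2_iff)
  let ?D = "\<lambda>\<omega>. (norm (x n \<omega> - z \<omega>))\<^sup>2"
  let ?g = "\<lambda>\<omega>. lam n \<omega> * ((z \<omega> + d n \<omega> - x n \<omega>) \<bullet> d n \<omega>)"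
  have int_D: "integrable M ?D"
    by (intro integrable_norm_power2_diff x_integrable int_z) simp_all
  have int_g: "integrable M ?g" by (rule cut_integrable[OF zM])
  have dec_meas[measurable]: "decrease n \<in> borel_measurable M" using decrease_integrable by auto
  have "AE \<omega> in M. (norm (x (Suc n) \<omega> - z \<omega>))\<^sup>2 = (?D \<omega> - decrease n \<omega>) + 2 * ?g \<omega>"
    using step[of n]
  proof eventually_elim
    case (elim \<omega>)
    show ?case unfolding elim decrease_def
      by (simp add: power2_norm_eq_inner inner_simps inner_commute algebra_simps)
  qed
  then have "AE \<omega> in M. real_cond_exp M (\<X> n) (\<lambda>\<omega>. (norm (x (Suc n) \<omega> - z \<omega>))\<^sup>2) \<omega>
      = real_cond_exp M (\<X> n) (\<lambda>\<omega>. (?D \<omega> - decrease n \<omega>) + 2 * ?g \<omega>) \<omega>"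
    by (rule S.real_cond_exp_cong) measurable
  moreover have "AE \<omega> in M. real_cond_exp M (\<X> n) (\<lambda>\<omega>. (?D \<omega> - decrease n \<omega>) + 2 * ?g \<omega>) \<omega>
      = real_cond_exp M (\<X> n) (\<lambda>\<omega>. ?D \<omega> - decrease n \<omega>) \<omega> + real_cond_exp M (\<X> n) (\<lambda>\<omega>. 2 * ?g \<omega>) \<omega>"
    by (intro S.real_cond_exp_add Bochner_Integration.integrable_diff int_D decrease_integrable integrable_mult_right int_g)
  moreover have "AE \<omega> in M. real_cond_exp M (\<X> n) (\<lambda>\<omega>. ?D \<omega> - decrease n \<omega>) \<omega>
      = real_cond_exp M (\<X> n) ?D \<omega> - real_cond_exp M (\<X> n) (decrease n) \<omega>"
    by (intro S.real_cond_exp_diff int_D decrease_integrable)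
  moreover have "AE \<omega> in M. real_cond_exp M (\<X> n) ?D \<omega> = ?D \<omega>"
    by (rule S.real_cond_exp_F_meas[OF int_D]) measurable
  moreover have "AE \<omega> in M. real_cond_exp M (\<X> n) (\<lambda>\<omega>. 2 * ?g \<omega>) \<omega> = 2 * real_cond_exp M (\<X> n) ?g \<omega>"
    by (rule S.real_cond_exp_cmult[OF int_g])
  moreover note cut_random_point[OF z]
  ultimately show ?thesis by eventually_elim simp
qed

proposition expectation_dist_random_point:
  assumes z: "z \<in> Lp_space M (\<X> n) 2 Z"
  shows "expectation (\<lambda>\<omega>. (norm (x (Suc n) \<omega> - z \<omega>))\<^sup>2)
    \<le> expectation (\<lambda>\<omega>. (norm (x n \<omega> - z \<omega>))\<^sup>2) - expectation (decrease n) + expectation (\<lambda>\<omega>. \<delta> n \<omega> (z \<omega>))"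
proof -
  interpret S: sigma_finite_subalgebra M "\<X> n" by (rule sigma_finite_subalgebra_F)
  have zM: "z \<in> Lp_space M M 2 UNIV" by (rule Lp_\<X>_imp_Lp[OF z])
  then have [measurable]: "z \<in> borel_measurable M" and int_z: "integrable M (\<lambda>\<omega>. (norm (z \<omega>))\<^sup>2)"
    by (simp_all add: Lp_space_2_iff)
  have int_D: "integrable M (\<lambda>\<omega>. (norm (x m \<omega> - z \<omega>))\<^sup>2)" for m
    by (intro integrable_norm_power2_diff x_integrable int_z) simp_all
  note ints = int_D \<delta>_integrable[OF zM] S.real_cond_exp_int(1)[OF decrease_integrable]
  have "expectation (\<lambda>\<omega>. (norm (x (Suc n) \<omega> - z \<omega>))\<^sup>2)
      = expectation (real_cond_exp M (\<X> n) (\<lambda>\<omega>. (norm (x (Suc n) \<omega> - z \<omega>))\<^sup>2))"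
    by (rule S.real_cond_exp_int(2)[symmetric, OF int_D])
  also have "\<dots> \<le> expectation (\<lambda>\<omega>. (norm (x n \<omega> - z \<omega>))\<^sup>2 - real_cond_exp M (\<X> n) (decrease n) \<omega> + \<delta> n \<omega> (z \<omega>))"
    by (intro integral_mono_AE cond_exp_dist_random_point[OF z] S.real_cond_exp_int(1)
        Bochner_Integration.integrable_add Bochner_Integration.integrable_diff ints)
  also have "\<dots> = expectation (\<lambda>\<omega>. (norm (x n \<omega> - z \<omega>))\<^sup>2) - expectation (decrease n) + expectation (\<lambda>\<omega>. \<delta> n \<omega> (z \<omega>))"
    using ints S.real_cond_exp_int(2)[OF decrease_integrable] by simp
  finally show ?thesis .
qed

lemma Fejer_at_point:
  assumes z: "z \<in> Z" and summ: "AE \<omega> in M. summable (\<lambda>n. \<delta> n \<omega> z)"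
  shows "AE \<omega> in M. convergent (\<lambda>n. norm (x n \<omega> - z)) \<and> summable (\<lambda>n. real_cond_exp M (\<X> n) (decrease n) \<omega>)"
proof -
  have "AE \<omega> in M. convergent (\<lambda>n. (norm (x n \<omega> - z))\<^sup>2) \<and> summable (\<lambda>n. real_cond_exp M (\<X> n) (decrease n) \<omega>)"
  proof (rule Robbins_Siegmund_dominated)
    show "integrable M (\<lambda>\<omega>. (norm (x n \<omega> - z))\<^sup>2)" for n
      by (intro integrable_norm_power2_diff x_integrable) simp_all
    show "integrable M (real_cond_exp M (\<X> n) (decrease n))" for n
      by (rule sigma_finite_subalgebra.real_cond_exp_int(1)[OF sigma_finite_subalgebra_F decrease_integrable])
    show "AE \<omega> in M. 0 \<le> real_cond_exp M (\<X> n) (decrease n) \<omega>" for n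
      using decrease_nonneg[of n] by (simp add: decrease_def[abs_def])
    show "AE \<omega> in M. real_cond_exp M (\<X> n) (\<lambda>\<omega>. (norm (x (Suc n) \<omega> - z))\<^sup>2) \<omega>
        \<le> (norm (x n \<omega> - z))\<^sup>2 - real_cond_exp M (\<X> n) (decrease n) \<omega> + \<delta> n \<omega> z" for n
      by (rule cond_exp_dist_random_point) (rule const_in_Lp[OF z])
  qed (use summ \<delta>_nonneg in auto)
  then show ?thesis
  proof eventually_elim
    case (elim \<omega>)
    then obtain a where "(\<lambda>n. (norm (x n \<omega> - z))\<^sup>2) \<longlonglongrightarrow> a" by (auto simp: convergent_def)
    then have "(\<lambda>n. sqrt ((norm (x n \<omega> - z))\<^sup>2)) \<longlonglongrightarrow> sqrt a" by (rule tendsto_real_sqrt)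
    then show ?case using elim by (auto simp: convergent_def)
  qed
qed

section \<open>Almost sure convergence\<close>

text \<open>
  The null set of \<open>Fejer_at_point\<close> depends on the point. Countably many points suffice, because
  \<open>z \<mapsto> \<parallel>x n - z\<parallel>\<close> is 1-Lipschitz for all \<open>n\<close>; this is what allows random points that are not
  measurable with respect to the past.
\<close>
lemma Fejer_all_points:
  assumes summ: "\<forall>z\<in>Z. AE \<omega> in M. summable (\<lambda>n. \<delta> n \<omega> z)"
  shows "AE \<omega> in M. \<forall>z\<in>Z. convergent (\<lambda>n. norm (x n \<omega> - z))"
proof -
  obtain D where D: "countable D" "D \<subseteq> Z" "Z \<subseteq> closure D" using separable[of Z] by metis
  have "AE \<omega> in M. \<forall>v\<in>D. convergent (\<lambda>n. norm (x n \<omega> - v))"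
  proof (rule AE_ball_countable'[OF _ D(1)])
    fix v assume "v \<in> D"
    then have "v \<in> Z" using D by blast
    from Fejer_at_point[OF this bspec[OF summ this]]
    show "AE \<omega> in M. convergent (\<lambda>n. norm (x n \<omega> - v))" by eventually_elim blast
  qed
  then show ?thesis
  proof eventually_elim
    case (elim \<omega>)
    show ?case
    proof
      fix z assume "z \<in> Z"
      then show "convergent (\<lambda>n. norm (x n \<omega> - z))"
        using convergent_norm_diff_dense[of D "\<lambda>n. x n \<omega>" z] elim D(3) by blast
    qed
  qed
qed

lemma AE_norm_bounded:
  assumes summ: "\<forall>z\<in>Z. AE \<omega> in M. summable (\<lambda>n. \<delta> n \<omega> z)"
  shows "AE \<omega> in M. \<exists>C. \<forall>n. norm (x n \<omega>) \<le> C"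
  using Fejer_all_points[OF summ]
proof eventually_elim
  case (elim \<omega>)
  obtain z where z: "z \<in> Z" using Z_nonempty by blast
  then have "Bseq (\<lambda>n. norm (x n \<omega> - z))" using elim by (simp add: convergent_imp_Bseq)
  then obtain B where B: "\<And>n. norm (x n \<omega> - z) \<le> B" by (auto simp: Bseq_def)
  have "norm (x n \<omega>) \<le> B + norm z" for n
    using B[of n] norm_triangle_sub[of "x n \<omega>" z] by linarith
  then show ?case by blast
qed

proposition AE_Bseq_norm:
  assumes summ: "\<forall>z\<in>Z. AE \<omega> in M. summable (\<lambda>n. \<delta> n \<omega> z)"
  shows "AE \<omega> in M. Bseq (\<lambda>n. norm (x n \<omega>))"
  using AE_norm_bounded[OF summ]
proof eventually_elim
  case (elim \<omega>)
  then obtain C where "\<And>n. norm (norm (x n \<omega>)) \<le> C" by auto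
  then show ?case by (rule BseqI')
qed

proposition AE_convergent_norm_diff:
  assumes summ: "\<forall>z\<in>Z. AE \<omega> in M. summable (\<lambda>n. \<delta> n \<omega> z)"
    and z: "AE \<omega> in M. z \<omega> \<in> Z"
  shows "AE \<omega> in M. convergent (\<lambda>n. norm (x n \<omega> - z \<omega>))"
  using Fejer_all_points[OF summ] z by eventually_elim blast

proposition AE_summable_decrease:
  assumes summ: "\<forall>z\<in>Z. AE \<omega> in M. summable (\<lambda>n. \<delta> n \<omega> z)"
  shows "AE \<omega> in M. summable (\<lambda>n. real_cond_exp M (\<X> n) (decrease n) \<omega>)"
proof -
  obtain z where z: "z \<in> Z" using Z_nonempty by blast
  from Fejer_at_point[OF this bspec[OF summ this]] show ?thesis by eventually_elim blast
qed

proposition weak_convergence: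
  assumes summ: "\<forall>z\<in>Z. AE \<omega> in M. summable (\<lambda>n. \<delta> n \<omega> z)"
    and cl: "AE \<omega> in M. weak_cluster_points (\<lambda>n. x n \<omega>) \<subseteq> Z"
  shows "\<exists>y \<in> M \<rightarrow>\<^sub>M restrict_space borel Z. AE \<omega> in M. weakly_converges (\<lambda>n. x n \<omega>) (y \<omega>)"
proof (rule measurable_weak_limit[OF x_measurable Z_nonempty])
  show "AE \<omega> in M. \<exists>l\<in>Z. weakly_converges (\<lambda>n. x n \<omega>) l"
    using cl Fejer_all_points[OF summ] AE_norm_bounded[OF summ]
  proof eventually_elim
    case (elim \<omega>)
    then obtain C where "\<And>n. norm (x n \<omega>) \<le> C" by blast
    then show ?case using elim(1,2) by (intro Opial) auto
  qed
qed

text \<open>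
  A strong cluster point \<open>l\<close> in \<open>Z\<close> forces the convergent distances \<open>\<parallel>x n - l\<parallel>\<close> to tend to
  \<open>0\<close>.
\<close>
proposition strong_convergence:
  assumes summ: "\<forall>z\<in>Z. AE \<omega> in M. summable (\<lambda>n. \<delta> n \<omega> z)"
    and cl: "AE \<omega> in M. strong_cluster_points (\<lambda>n. x n \<omega>) \<inter> Z \<noteq> {}"
  shows "\<exists>y \<in> M \<rightarrow>\<^sub>M restrict_space borel Z. AE \<omega> in M. (\<lambda>n. x n \<omega>) \<longlonglongrightarrow> y \<omega>"
proof -
  have lim: "AE \<omega> in M. \<exists>l\<in>Z. (\<lambda>n. x n \<omega>) \<longlonglongrightarrow> l"
    using cl Fejer_all_points[OF summ]
  proof eventually_elim
    case (elim \<omega>)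
    then obtain l where "l \<in> strong_cluster_points (\<lambda>n. x n \<omega>)" "l \<in> Z" by blast
    then show ?case using elim(2) tendsto_of_strong_cluster_point[of "\<lambda>n. x n \<omega>" l] by blast
  qed
  then have "AE \<omega> in M. \<exists>l\<in>Z. weakly_converges (\<lambda>n. x n \<omega>) l"
    by eventually_elim (blast intro: tendsto_imp_weakly_converges)
  from measurable_weak_limit[OF x_measurable Z_nonempty this]
  obtain y where y: "y \<in> M \<rightarrow>\<^sub>M restrict_space borel Z"
    and conv: "AE \<omega> in M. weakly_converges (\<lambda>n. x n \<omega>) (y \<omega>)" by blast
  from lim conv have "AE \<omega> in M. (\<lambda>n. x n \<omega>) \<longlonglongrightarrow> y \<omega>"
  proof eventually_elim
    case (elim \<omega>)
    then obtain l where l: "(\<lambda>n. x n \<omega>) \<longlonglongrightarrow> l" by blast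
    then have "l = y \<omega>" using tendsto_imp_weakly_converges elim(2) weakly_converges_unique by blast
    then show ?case using l by simp
  qed
  then show ?thesis using y by blast
qed

proposition strong_convergence_of_cluster_point:
  assumes summ: "\<forall>z\<in>Z. AE \<omega> in M. summable (\<lambda>n. \<delta> n \<omega> z)"
    and "AE \<omega> in M. strong_cluster_points (\<lambda>n. x n \<omega>) \<noteq> {}"
    and "AE \<omega> in M. weak_cluster_points (\<lambda>n. x n \<omega>) \<subseteq> Z"
  shows "\<exists>y \<in> M \<rightarrow>\<^sub>M restrict_space borel Z. AE \<omega> in M. (\<lambda>n. x n \<omega>) \<longlonglongrightarrow> y \<omega>"
proof (rule strong_convergence[OF summ])
  show "AE \<omega> in M. strong_cluster_points (\<lambda>n. x n \<omega>) \<inter> Z \<noteq> {}"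
    using assms(2,3) by eventually_elim (use strong_cluster_points_subset_weak in blast)
qed

section \<open>Convergence in mean\<close>

lemma AE_summable_of_summable_expectation:
  assumes summ: "\<forall>z\<in>Z. summable (\<lambda>n. expectation (\<lambda>\<omega>. \<delta> n \<omega> z))"
  shows "\<forall>z\<in>Z. AE \<omega> in M. summable (\<lambda>n. \<delta> n \<omega> z)"
proof
  fix z assume z: "z \<in> Z"
  have int: "integrable M (\<lambda>\<omega>. \<delta> n \<omega> z)" for n
    by (rule \<delta>_integrable) (rule const_in_Lp[OF UNIV_I])
  have nn: "0 \<le> expectation (\<lambda>\<omega>. \<delta> n \<omega> z)" for n
    by (rule integral_nonneg_AE) (simp add: \<delta>_nonneg)
  have "AE \<omega> in M. \<exists>K. \<forall>n. (\<Sum>k<n. \<delta> k \<omega> z) \<le> K"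
  proof (rule AE_bounded_of_monotone_expectation)
    show "expectation (\<lambda>\<omega>. \<Sum>k<n. \<delta> k \<omega> z) \<le> (\<Sum>n. expectation (\<lambda>\<omega>. \<delta> n \<omega> z))" for n
      using int sum_le_suminf[OF bspec[OF summ z], of "{..<n}"] nn by (simp add: Bochner_Integration.integral_sum)
  qed (auto intro!: Bochner_Integration.integrable_sum int sum_nonneg \<delta>_nonneg)
  with AE_space show "AE \<omega> in M. summable (\<lambda>n. \<delta> n \<omega> z)"
  proof eventually_elim
    case (elim \<omega>)
    then obtain K where "\<And>n. (\<Sum>k<n. \<delta> k \<omega> z) \<le> K" by blast
    then show ?case using \<delta>_nonneg[OF elim(1)] by (intro summableI_nonneg_bounded)
  qed
qed

text \<open>
  The inequality in the mean summed over time; it yields the bound in \<open>L\<^sup>2\<close> and the summability of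
  the expected decrease.
\<close>
lemma expectation_telescoped:
  assumes z: "z \<in> Z" and summ: "summable (\<lambda>n. expectation (\<lambda>\<omega>. \<delta> n \<omega> z))"
  shows "expectation (\<lambda>\<omega>. (norm (x n \<omega> - z))\<^sup>2) + (\<Sum>k<n. expectation (decrease k))
    \<le> expectation (\<lambda>\<omega>. (norm (x 0 \<omega> - z))\<^sup>2) + (\<Sum>n. expectation (\<lambda>\<omega>. \<delta> n \<omega> z))"
proof -
  have "expectation (\<lambda>\<omega>. (norm (x n \<omega> - z))\<^sup>2) + (\<Sum>k<n. expectation (decrease k))
    \<le> expectation (\<lambda>\<omega>. (norm (x 0 \<omega> - z))\<^sup>2) + (\<Sum>k<n. expectation (\<lambda>\<omega>. \<delta> k \<omega> z))"
  proof (induction n)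
    case (Suc n)
    then show ?case using expectation_dist_random_point[OF const_in_Lp[OF z], of n] by simp
  qed simp
  moreover have "0 \<le> expectation (\<lambda>\<omega>. \<delta> n \<omega> z)" for n
    by (rule integral_nonneg_AE) (simp add: \<delta>_nonneg)
  ultimately show ?thesis using sum_le_suminf[OF summ, of "{..<n}"] by fastforce
qed

lemma L2_bounded:
  assumes summ: "\<forall>z\<in>Z. summable (\<lambda>n. expectation (\<lambda>\<omega>. \<delta> n \<omega> z))"
  obtains C where "\<And>n. expectation (\<lambda>\<omega>. (norm (x n \<omega>))\<^sup>2) \<le> C"
proof -
  obtain z where z: "z \<in> Z" using Z_nonempty by blast
  define B where "B = expectation (\<lambda>\<omega>. (norm (x 0 \<omega> - z))\<^sup>2) + (\<Sum>n. expectation (\<lambda>\<omega>. \<delta> n \<omega> z))"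
  have "expectation (\<lambda>\<omega>. (norm (x n \<omega>))\<^sup>2) \<le> 2 * B + 2 * (norm z)\<^sup>2" for n
  proof -
    have int: "integrable M (\<lambda>\<omega>. (norm (x n \<omega> - z))\<^sup>2)"
      by (intro integrable_norm_power2_diff x_integrable) simp_all
    have "expectation (\<lambda>\<omega>. (norm (x n \<omega>))\<^sup>2) \<le> expectation (\<lambda>\<omega>. 2 * (norm (x n \<omega> - z))\<^sup>2 + 2 * (norm z)\<^sup>2)"
    proof (rule integral_mono)
      show "(norm (x n \<omega>))\<^sup>2 \<le> 2 * (norm (x n \<omega> - z))\<^sup>2 + 2 * (norm z)\<^sup>2" for \<omega>
        using norm_diff_power2_le[of "x n \<omega> - z" "- z"] by simp
    qed (use int x_integrable in auto)
    also have "\<dots> = 2 * expectation (\<lambda>\<omega>. (norm (x n \<omega> - z))\<^sup>2) + 2 * (norm z)\<^sup>2"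
      using int by (simp add: prob_space)
    finally have "expectation (\<lambda>\<omega>. (norm (x n \<omega>))\<^sup>2) \<le> 2 * expectation (\<lambda>\<omega>. (norm (x n \<omega> - z))\<^sup>2) + 2 * (norm z)\<^sup>2" .
    moreover have "0 \<le> (\<Sum>k<n. expectation (decrease k))" by (intro sum_nonneg expectation_decrease_nonneg)
    moreover note expectation_telescoped[OF z bspec[OF summ z], of n, folded B_def]
    moreover have "a \<le> 2 * B + c" if "a \<le> 2 * b + c" "0 \<le> s" "b + s \<le> B" for a b c s :: real
      using that by linarith
    ultimately show ?thesis by blast
  qed
  then show ?thesis by (rule that)
qed

proposition Bseq_L2_norm:
  assumes summ: "\<forall>z\<in>Z. summable (\<lambda>n. expectation (\<lambda>\<omega>. \<delta> n \<omega> z))"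
  shows "Bseq (\<lambda>n. Lp_norm M 2 (x n))"
proof -
  obtain C where C: "\<And>n. expectation (\<lambda>\<omega>. (norm (x n \<omega>))\<^sup>2) \<le> C" using L2_bounded[OF summ] by blast
  have "norm (Lp_norm M 2 (x n)) \<le> sqrt C" for n
    using C[of n] by (intro real_le_rsqrt) (simp add: Lp_norm_2_power2)
  then show ?thesis by (rule BseqI')
qed

proposition summable_expectation_decrease:
  assumes summ: "\<forall>z\<in>Z. summable (\<lambda>n. expectation (\<lambda>\<omega>. \<delta> n \<omega> z))"
  shows "summable (\<lambda>n. expectation (decrease n))"
proof -
  obtain z where z: "z \<in> Z" using Z_nonempty by blast
  show ?thesis
  proof (rule summableI_nonneg_bounded[OF expectation_decrease_nonneg])
    fix n
    have "0 \<le> expectation (\<lambda>\<omega>. (norm (x n \<omega> - z))\<^sup>2)" by simp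
    then show "(\<Sum>k<n. expectation (decrease k))
        \<le> expectation (\<lambda>\<omega>. (norm (x 0 \<omega> - z))\<^sup>2) + (\<Sum>n. expectation (\<lambda>\<omega>. \<delta> n \<omega> z))"
      using expectation_telescoped[OF z bspec[OF summ z], of n] by linarith
  qed
qed

lemma L2_bounded_diff:
  assumes summ: "\<forall>z\<in>Z. summable (\<lambda>n. expectation (\<lambda>\<omega>. \<delta> n \<omega> z))"
    and y: "y \<in> Lp_space M M 2 UNIV"
  obtains C where "\<And>n. integrable M (\<lambda>\<omega>. (norm (x n \<omega> - y \<omega>))\<^sup>2)"
    and "\<And>n. expectation (\<lambda>\<omega>. (norm (x n \<omega> - y \<omega>))\<^sup>2) \<le> C"
proof -
  obtain C where C: "\<And>n. expectation (\<lambda>\<omega>. (norm (x n \<omega>))\<^sup>2) \<le> C" using L2_bounded[OF summ] by blast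
  have y_meas: "y \<in> borel_measurable M" and int_y: "integrable M (\<lambda>\<omega>. (norm (y \<omega>))\<^sup>2)"
    using y by (simp_all add: Lp_space_2_iff)
  have int: "integrable M (\<lambda>\<omega>. (norm (x n \<omega> - y \<omega>))\<^sup>2)" for n
    by (intro integrable_norm_power2_diff x_integrable int_y y_meas x_measurable)
  have "expectation (\<lambda>\<omega>. (norm (x n \<omega> - y \<omega>))\<^sup>2) \<le> 2 * C + 2 * expectation (\<lambda>\<omega>. (norm (y \<omega>))\<^sup>2)" for n
  proof -
    have "expectation (\<lambda>\<omega>. (norm (x n \<omega> - y \<omega>))\<^sup>2) \<le> expectation (\<lambda>\<omega>. 2 * (norm (x n \<omega>))\<^sup>2 + 2 * (norm (y \<omega>))\<^sup>2)"
      by (intro integral_mono int Bochner_Integration.integrable_add integrable_mult_right x_integrable int_y norm_diff_power2_le)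
    also have "\<dots> = 2 * expectation (\<lambda>\<omega>. (norm (x n \<omega>))\<^sup>2) + 2 * expectation (\<lambda>\<omega>. (norm (y \<omega>))\<^sup>2)"
      using x_integrable int_y by simp
    finally show ?thesis using C[of n] by linarith
  qed
  then show ?thesis using int that by blast
qed

text \<open>
  The inequality in the mean holds for points that are measurable with respect to the past, which
  \<open>z\<close> may fail to be. The distances converge almost surely to some \<open>l\<close>, and the bound in
  \<open>L\<^sup>2\<close> makes them converge in the mean.
\<close>
proposition convergent_L1_norm_diff:
  assumes summ: "\<forall>z\<in>Z. summable (\<lambda>n. expectation (\<lambda>\<omega>. \<delta> n \<omega> z))"
    and z: "z \<in> Lp_space M M 2 Z"
  shows "convergent (\<lambda>n. Lp_norm M 1 (\<lambda>\<omega>. x n \<omega> - z \<omega>))"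
proof -
  have [measurable]: "z \<in> borel_measurable M" and z_Z: "AE \<omega> in M. z \<omega> \<in> Z"
    using z by (simp_all add: Lp_space_2_iff)
  have "z \<in> Lp_space M M 2 UNIV" using z by (simp add: Lp_space_2_iff)
  then obtain C where int: "\<And>n. integrable M (\<lambda>\<omega>. (norm (x n \<omega> - z \<omega>))\<^sup>2)"
    and C: "\<And>n. expectation (\<lambda>\<omega>. (norm (x n \<omega> - z \<omega>))\<^sup>2) \<le> C"
    using L2_bounded_diff[OF summ] by blast
  define l where "l \<omega> = lim (\<lambda>n. norm (x n \<omega> - z \<omega>))" for \<omega>
  have [measurable]: "l \<in> borel_measurable M" unfolding l_def by measurable
  have lim: "AE \<omega> in M. (\<lambda>n. norm (x n \<omega> - z \<omega>)) \<longlonglongrightarrow> l \<omega>"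
    using AE_convergent_norm_diff[OF AE_summable_of_summable_expectation[OF summ] z_Z]
    by eventually_elim (auto simp: l_def convergent_LIMSEQ_iff)
  have int_l: "integrable M (\<lambda>\<omega>. (l \<omega>)\<^sup>2)"
  proof (rule Fatou_L2[OF int C])
    show "AE \<omega> in M. \<forall>c. (\<exists>\<^sub>F n in sequentially. (norm (x n \<omega> - z \<omega>))\<^sup>2 < c) \<longrightarrow> (l \<omega>)\<^sup>2 \<le> c"
      using lim
    proof eventually_elim
      case (elim \<omega>)
      then have "(\<lambda>n. (norm (x n \<omega> - z \<omega>))\<^sup>2) \<longlonglongrightarrow> (l \<omega>)\<^sup>2" by (intro tendsto_intros)
      then have "c < (l \<omega>)\<^sup>2 \<Longrightarrow> \<forall>\<^sub>F n in sequentially. c < (norm (x n \<omega> - z \<omega>))\<^sup>2" for c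
        by (rule order_tendstoD)
      then show ?case by (metis (mono_tags, lifting) frequently_def eventually_mono less_asym not_le)
    qed
  qed simp
  define f where "f n \<omega> = norm (x n \<omega> - z \<omega>) - l \<omega>" for n \<omega>
  have int_f: "integrable M (\<lambda>\<omega>. (f n \<omega>)\<^sup>2)" for n
    using integrable_norm_power2_diff[of "\<lambda>\<omega>. norm (x n \<omega> - z \<omega>)" M l] int[of n] int_l by (simp add: f_def)
  have lim_f: "(\<lambda>n. expectation (\<lambda>\<omega>. \<bar>f n \<omega>\<bar>)) \<longlonglongrightarrow> 0"
  proof (rule integral_tendsto_0_of_L2_bounded[OF finite_measure_axioms])
    show "f n \<in> borel_measurable M" for n unfolding f_def by measurable
    show "AE \<omega> in M. (\<lambda>n. f n \<omega>) \<longlonglongrightarrow> 0"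
      using lim by eventually_elim (simp add: f_def LIM_zero)
    show "expectation (\<lambda>\<omega>. (f n \<omega>)\<^sup>2) \<le> 2 * C + 2 * expectation (\<lambda>\<omega>. (l \<omega>)\<^sup>2)" for n
    proof -
      have "expectation (\<lambda>\<omega>. (f n \<omega>)\<^sup>2) \<le> expectation (\<lambda>\<omega>. 2 * (norm (x n \<omega> - z \<omega>))\<^sup>2 + 2 * (l \<omega>)\<^sup>2)"
      proof (rule integral_mono)
        show "(f n \<omega>)\<^sup>2 \<le> 2 * (norm (x n \<omega> - z \<omega>))\<^sup>2 + 2 * (l \<omega>)\<^sup>2" for \<omega>
          using norm_diff_power2_le[of "norm (x n \<omega> - z \<omega>)" "l \<omega>"] by (simp add: f_def)
      qed (use int int_l int_f in auto)
      also have "\<dots> = 2 * expectation (\<lambda>\<omega>. (norm (x n \<omega> - z \<omega>))\<^sup>2) + 2 * expectation (\<lambda>\<omega>. (l \<omega>)\<^sup>2)"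
        using int int_l by simp
      finally show ?thesis using C[of n] by linarith
    qed
  qed (rule int_f)
  have bound: "norm (Lp_norm M 1 (\<lambda>\<omega>. x n \<omega> - z \<omega>) - expectation l) \<le> expectation (\<lambda>\<omega>. \<bar>f n \<omega>\<bar>)" for n
  proof -
    have "integrable M (\<lambda>\<omega>. norm (x n \<omega> - z \<omega>))"
      by (rule integrable_norm[OF integrable_of_integrable_power2[OF finite_measure_axioms _ int]]) simp
    moreover have "integrable M l"
      by (rule integrable_of_integrable_power2[OF finite_measure_axioms]) (use int_l in auto)
    ultimately have "Lp_norm M 1 (\<lambda>\<omega>. x n \<omega> - z \<omega>) - expectation l = expectation (f n)"
      by (simp add: Lp_norm_1 f_def[abs_def])
    then show ?thesis using integral_norm_bound[of M "f n"] by simp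
  qed
  have "(\<lambda>n. Lp_norm M 1 (\<lambda>\<omega>. x n \<omega> - z \<omega>) - expectation l) \<longlonglongrightarrow> 0"
    by (rule Lim_null_comparison[OF always_eventually[OF allI[OF bound]] lim_f])
  then show ?thesis by (auto simp: convergent_def dest: LIM_zero_cancel)
qed

proposition weak_L2_convergence:
  assumes summ: "\<forall>z\<in>Z. summable (\<lambda>n. expectation (\<lambda>\<omega>. \<delta> n \<omega> z))"
    and y_meas[measurable]: "y \<in> borel_measurable M"
    and conv: "AE \<omega> in M. weakly_converges (\<lambda>n. x n \<omega>) (y \<omega>)"
  shows "y \<in> Lp_space M M 2 UNIV" and "weakly_converges_L2 M x y"
proof -
  obtain C where C: "\<And>n. expectation (\<lambda>\<omega>. (norm (x n \<omega>))\<^sup>2) \<le> C" using L2_bounded[OF summ] by blast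
  have "integrable M (\<lambda>\<omega>. (norm (y \<omega>))\<^sup>2)"
  proof (rule Fatou_L2[OF x_integrable C])
    show "AE \<omega> in M. \<forall>c. (\<exists>\<^sub>F n in sequentially. (norm (x n \<omega>))\<^sup>2 < c) \<longrightarrow> (norm (y \<omega>))\<^sup>2 \<le> c"
      using conv
    proof eventually_elim
      case (elim \<omega>)
      have "(norm (y \<omega>))\<^sup>2 \<le> c" if "\<exists>\<^sub>F n in sequentially. (norm (x n \<omega>))\<^sup>2 < c" for c
      proof -
        have "\<exists>\<^sub>F n in sequentially. norm (x n \<omega>) \<le> sqrt c"
          using that by (rule frequently_elim1) (auto intro: real_le_rsqrt less_imp_le)
        then have "norm (y \<omega>) \<le> sqrt c" by (rule norm_le_of_weakly_converges[OF elim])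
        then show ?thesis by (simp add: sqrt_ge_absD)
      qed
      then show ?case by blast
    qed
  qed simp
  then show y: "y \<in> Lp_space M M 2 UNIV" by (simp add: Lp_space_2_iff)
  obtain B where int: "\<And>n. integrable M (\<lambda>\<omega>. (norm (x n \<omega> - y \<omega>))\<^sup>2)"
    and B: "\<And>n. expectation (\<lambda>\<omega>. (norm (x n \<omega> - y \<omega>))\<^sup>2) \<le> B"
    using L2_bounded_diff[OF summ y] by blast
  have "(\<lambda>n. expectation (\<lambda>\<omega>. x n \<omega> \<bullet> w \<omega>)) \<longlonglongrightarrow> expectation (\<lambda>\<omega>. y \<omega> \<bullet> w \<omega>)"
    if w: "w \<in> Lp_space M M 2 UNIV" for w
  proof -
    have [measurable]: "w \<in> borel_measurable M" and int_w: "integrable M (\<lambda>\<omega>. (norm (w \<omega>))\<^sup>2)"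
      using w by (simp_all add: Lp_space_2_iff)
    have int_y: "integrable M (\<lambda>\<omega>. (norm (y \<omega>))\<^sup>2)" using y by (simp add: Lp_space_2_iff)
    have lim_f: "(\<lambda>n. expectation (\<lambda>\<omega>. \<bar>(x n \<omega> - y \<omega>) \<bullet> w \<omega>\<bar>)) \<longlonglongrightarrow> 0"
    proof (rule integral_dominated_by_L2_products[where h="\<lambda>n \<omega>. norm (x n \<omega> - y \<omega>)" and k="\<lambda>\<omega>. norm (w \<omega>)", OF _ _ _ int B])
      show "AE \<omega> in M. (\<lambda>n. (x n \<omega> - y \<omega>) \<bullet> w \<omega>) \<longlonglongrightarrow> 0"
        using conv by eventually_elim (simp add: inner_diff_left weakly_converges_def LIM_zero)
    qed (use int_w Cauchy_Schwarz_ineq2 in auto)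
    have bound: "norm (expectation (\<lambda>\<omega>. x n \<omega> \<bullet> w \<omega>) - expectation (\<lambda>\<omega>. y \<omega> \<bullet> w \<omega>))
        \<le> expectation (\<lambda>\<omega>. \<bar>(x n \<omega> - y \<omega>) \<bullet> w \<omega>\<bar>)" for n
    proof -
      have "expectation (\<lambda>\<omega>. x n \<omega> \<bullet> w \<omega>) - expectation (\<lambda>\<omega>. y \<omega> \<bullet> w \<omega>) = expectation (\<lambda>\<omega>. (x n \<omega> - y \<omega>) \<bullet> w \<omega>)"
        unfolding inner_diff_left
        by (rule Bochner_Integration.integral_diff[symmetric]; rule integrable_inner)
          (use x_integrable int_y int_w in simp_all)
      then show ?thesis using integral_norm_bound[of M "\<lambda>\<omega>. (x n \<omega> - y \<omega>) \<bullet> w \<omega>"] by simp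
    qed
    have "(\<lambda>n. expectation (\<lambda>\<omega>. x n \<omega> \<bullet> w \<omega>) - expectation (\<lambda>\<omega>. y \<omega> \<bullet> w \<omega>)) \<longlonglongrightarrow> 0"
      by (rule Lim_null_comparison[OF always_eventually[OF allI[OF bound]] lim_f])
    then show ?thesis by (rule LIM_zero_cancel)
  qed
  then show "weakly_converges_L2 M x y"
    using x_in_L2 y by (simp add: weakly_converges_L2_def)
qed

lemma in_L1: "y \<in> Lp_space M M 1 UNIV \<longleftrightarrow> integrable M y" for y :: "'w \<Rightarrow> 'h"
proof -
  have "subalgebra M M" by (simp add: subalgebra_def)
  from Lp_space_1_iff[OF this, of y UNIV] show ?thesis by auto
qed

text \<open>
  Almost sure convergence gives convergence in \<open>L\<^sup>1\<close> by uniform integrability. Conversely,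
  convergence in \<open>L\<^sup>1\<close> makes \<open>y \<omega>\<close> a strong cluster point along
  a subsequence, and the almost sure convergence of the distances to \<open>y \<omega>\<close> gives the whole
  sequence.
\<close>
proposition strong_L1_convergence:
  assumes summ: "\<forall>z\<in>Z. summable (\<lambda>n. expectation (\<lambda>\<omega>. \<delta> n \<omega> z))"
    and y_meas: "y \<in> borel_measurable M" and y_Z: "AE \<omega> in M. y \<omega> \<in> Z"
  shows "(AE \<omega> in M. (\<lambda>n. x n \<omega>) \<longlonglongrightarrow> y \<omega>) \<longleftrightarrow> Lp_converges M 1 x y"
proof
  assume conv: "AE \<omega> in M. (\<lambda>n. x n \<omega>) \<longlonglongrightarrow> y \<omega>"
  then have "AE \<omega> in M. weakly_converges (\<lambda>n. x n \<omega>) (y \<omega>)"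
    by eventually_elim (rule tendsto_imp_weakly_converges)
  from weak_L2_convergence(1)[OF summ y_meas this] have y: "y \<in> Lp_space M M 2 UNIV" .
  obtain B where int: "\<And>n. integrable M (\<lambda>\<omega>. (norm (x n \<omega> - y \<omega>))\<^sup>2)"
    and B: "\<And>n. expectation (\<lambda>\<omega>. (norm (x n \<omega> - y \<omega>))\<^sup>2) \<le> B"
    using L2_bounded_diff[OF summ y] by blast
  have "(\<lambda>n. expectation (\<lambda>\<omega>. \<bar>norm (x n \<omega> - y \<omega>)\<bar>)) \<longlonglongrightarrow> 0"
  proof (rule integral_tendsto_0_of_L2_bounded[OF finite_measure_axioms _ _ int B])
    show "AE \<omega> in M. (\<lambda>n. norm (x n \<omega> - y \<omega>)) \<longlonglongrightarrow> 0"
      using conv by eventually_elim (simp add: LIM_zero tendsto_norm_zero)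
  qed (use y_meas in measurable)
  moreover have "integrable M y"
    by (rule integrable_of_integrable_power2[OF finite_measure_axioms]) (use y in \<open>auto simp: Lp_space_2_iff\<close>)
  moreover have "integrable M (x n)" for n
    by (rule integrable_of_integrable_power2[OF finite_measure_axioms x_measurable x_integrable])
  ultimately show "Lp_converges M 1 x y" by (simp add: Lp_converges_def in_L1 Lp_norm_1)
next
  assume L1: "Lp_converges M 1 x y"
  then have "integrable M (\<lambda>\<omega>. x n \<omega> - y \<omega>)" for n by (auto simp: Lp_converges_def in_L1)
  moreover have "(\<lambda>n. expectation (\<lambda>\<omega>. norm (x n \<omega> - y \<omega>))) \<longlonglongrightarrow> 0"
    using L1 by (simp add: Lp_converges_def Lp_norm_1)
  ultimately obtain r where r: "strict_mono r" "AE \<omega> in M. (\<lambda>n. x (r n) \<omega> - y \<omega>) \<longlonglongrightarrow> 0"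
    using tendsto_L1_AE_subseq[of M "\<lambda>n \<omega>. x n \<omega> - y \<omega>"] by blast
  show "AE \<omega> in M. (\<lambda>n. x n \<omega>) \<longlonglongrightarrow> y \<omega>"
    using r(2) AE_convergent_norm_diff[OF AE_summable_of_summable_expectation[OF summ] y_Z]
  proof eventually_elim
    case (elim \<omega>)
    have "(\<lambda>n. x (r n) \<omega>) \<longlonglongrightarrow> y \<omega>" using elim(1) by (rule LIM_zero_cancel)
    then have "y \<omega> \<in> strong_cluster_points (\<lambda>n. x n \<omega>)"
      using r(1) by (auto simp: strong_cluster_points_def comp_def)
    then show ?case using elim(2) by (intro tendsto_of_strong_cluster_point)
  qed
qed

end

theorem theorem3p2:
  fixes M :: "'w measure"
    and Z :: "'h :: {real_inner, banach, second_countable_topology} set"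
    and x d :: "nat \<Rightarrow> 'w \<Rightarrow> 'h"
    and lam :: "nat \<Rightarrow> 'w \<Rightarrow> real"
    and \<delta> :: "nat \<Rightarrow> 'w \<Rightarrow> 'h \<Rightarrow> real"
  assumes "prob_space M" and "complete_measure M"
    and "closed Z" and "Z \<noteq> {}"
    and "x 0 \<in> Lp_space M M 2 UNIV"
    and "\<And>n. lam n \<in> Linf_space M M {0<..}"
    and "\<And>n. d n \<in> Lp_space M M 2 UNIV"
    and "\<And>n. \<delta> n \<in> integrand_class M"
    and "\<And>n. AE \<omega> in M.
          real_cond_exp M (generated_algebra M x n) (\<lambda>\<omega>. lam n \<omega> * (2 - lam n \<omega>) * (norm (d n \<omega>))\<^sup>2) \<omega> \<ge> 0"
    and "\<And>n z. z \<in> Z \<Longrightarrow> AE \<omega> in M.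
          real_cond_exp M (generated_algebra M x n) (\<lambda>\<omega>. lam n \<omega> * ((z + d n \<omega> - x n \<omega>) \<bullet> d n \<omega>)) \<omega> \<le> \<delta> n \<omega> z / 2"
    and "\<And>n. AE \<omega> in M. x (Suc n) \<omega> = x n \<omega> - lam n \<omega> *\<^sub>R d n \<omega>"
  shows
    "\<comment> \<open>(i)\<close>
     (\<forall>n. x n \<in> Lp_space M M 2 UNIV) \<and>
     \<comment> \<open>(ii)\<close>
     (\<forall>n. \<forall>z\<in>Z. AE \<omega> in M.
        real_cond_exp M (generated_algebra M x n) (\<lambda>\<omega>. (norm (x (Suc n) \<omega> - z))\<^sup>2) \<omega>
          \<le> (norm (x n \<omega> - z))\<^sup>2
             - real_cond_exp M (generated_algebra M x n) (\<lambda>\<omega>. lam n \<omega> * (2 - lam n \<omega>) * (norm (d n \<omega>))\<^sup>2) \<omega>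
             + \<delta> n \<omega> z) \<and>
     \<comment> \<open>(iii)\<close>
     (\<forall>n. \<forall>z\<in>Lp_space M (generated_algebra M x n) 2 Z. AE \<omega> in M.
        real_cond_exp M (generated_algebra M x n) (\<lambda>\<omega>. (norm (x (Suc n) \<omega> - z \<omega>))\<^sup>2) \<omega>
          \<le> (norm (x n \<omega> - z \<omega>))\<^sup>2
             - real_cond_exp M (generated_algebra M x n) (\<lambda>\<omega>. lam n \<omega> * (2 - lam n \<omega>) * (norm (d n \<omega>))\<^sup>2) \<omega>
             + \<delta> n \<omega> (z \<omega>)) \<and>
     \<comment> \<open>(iv)\<close>
     (\<forall>n. \<forall>z\<in>Lp_space M (generated_algebra M x n) 2 Z.
        (Lp_norm M 2 (\<lambda>\<omega>. x (Suc n) \<omega> - z \<omega>))\<^sup>2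
          \<le> (Lp_norm M 2 (\<lambda>\<omega>. x n \<omega> - z \<omega>))\<^sup>2
             - (\<integral>\<omega>. lam n \<omega> * (2 - lam n \<omega>) * (norm (d n \<omega>))\<^sup>2 \<partial>M)
             + (\<integral>\<omega>. \<delta> n \<omega> (z \<omega>) \<partial>M)) \<and>
     \<comment> \<open>(v)\<close>
     ((\<forall>z\<in>Z. AE \<omega> in M. summable (\<lambda>n. \<delta> n \<omega> z)) \<longrightarrow>
        \<comment> \<open>(a)\<close>
        (AE \<omega> in M. Bseq (\<lambda>n. norm (x n \<omega>))) \<and>
        \<comment> \<open>(b)\<close>
        (\<forall>z \<in> M \<rightarrow>\<^sub>M restrict_space borel Z. AE \<omega> in M. convergent (\<lambda>n. norm (x n \<omega> - z \<omega>))) \<and>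
        \<comment> \<open>(c)\<close>
        (AE \<omega> in M. summable (\<lambda>n.
           real_cond_exp M (generated_algebra M x n) (\<lambda>\<omega>. lam n \<omega> * (2 - lam n \<omega>) * (norm (d n \<omega>))\<^sup>2) \<omega>)) \<and>
        \<comment> \<open>(d)\<close>
        ((AE \<omega> in M. weak_cluster_points (\<lambda>n. x n \<omega>) \<subseteq> Z) \<longrightarrow>
           (\<exists>y \<in> M \<rightarrow>\<^sub>M restrict_space borel Z.
              AE \<omega> in M. weakly_converges (\<lambda>n. x n \<omega>) (y \<omega>))) \<and>
        \<comment> \<open>(e)\<close>
        ((AE \<omega> in M. strong_cluster_points (\<lambda>n. x n \<omega>) \<inter> Z \<noteq> {}) \<longrightarrow>
           (\<exists>y \<in> M \<rightarrow>\<^sub>M restrict_space borel Z.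
              AE \<omega> in M. (\<lambda>n. x n \<omega>) \<longlonglongrightarrow> y \<omega>)) \<and>
        \<comment> \<open>(f)\<close>
        ((AE \<omega> in M. strong_cluster_points (\<lambda>n. x n \<omega>) \<noteq> {}) \<and>
         (AE \<omega> in M. weak_cluster_points (\<lambda>n. x n \<omega>) \<subseteq> Z) \<longrightarrow>
           (\<exists>y \<in> M \<rightarrow>\<^sub>M restrict_space borel Z.
              AE \<omega> in M. (\<lambda>n. x n \<omega>) \<longlonglongrightarrow> y \<omega>))) \<and>
     \<comment> \<open>(vi)\<close>
     ((\<forall>z\<in>Z. summable (\<lambda>n. \<integral>\<omega>. \<delta> n \<omega> z \<partial>M)) \<longrightarrow>
        \<comment> \<open>(a)\<close>
        Bseq (\<lambda>n. Lp_norm M 2 (x n)) \<and>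
        \<comment> \<open>(b)\<close>
        (\<forall>z\<in>Lp_space M M 2 Z. convergent (\<lambda>n. Lp_norm M 1 (\<lambda>\<omega>. x n \<omega> - z \<omega>))) \<and>
        \<comment> \<open>(c)\<close>
        summable (\<lambda>n. \<integral>\<omega>. lam n \<omega> * (2 - lam n \<omega>) * (norm (d n \<omega>))\<^sup>2 \<partial>M) \<and>
        \<comment> \<open>(d)\<close>
        (\<forall>y \<in> borel_measurable M. (AE \<omega> in M. weakly_converges (\<lambda>n. x n \<omega>) (y \<omega>)) \<longrightarrow>
           y \<in> Lp_space M M 2 UNIV \<and> weakly_converges_L2 M x y) \<and>
        \<comment> \<open>(e)\<close>
        (\<forall>y \<in> M \<rightarrow>\<^sub>M restrict_space borel Z.
           ((AE \<omega> in M. (\<lambda>n. x n \<omega>) \<longlonglongrightarrow> y \<omega>) \<longleftrightarrow> Lp_converges M 1 x y) \<and>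
           ((AE \<omega> in M. (\<lambda>n. x n \<omega>) \<longlonglongrightarrow> y \<omega>) \<longrightarrow>
              y \<in> Lp_space M M 2 Z \<and> weakly_converges_L2 M x y)))"
proof -
  interpret stochastic_Fejer M Z x d lam \<delta>
    using assms by (intro stochastic_Fejer.intro stochastic_Fejer_axioms.intro)
  have rv: "y \<in> borel_measurable M \<and> (AE \<omega> in M. y \<omega> \<in> Z)" if "y \<in> M \<rightarrow>\<^sub>M restrict_space borel Z" for y :: "'w \<Rightarrow> 'h"
    using that measurable_space[OF that] by (auto simp: measurable_restrict_space2_iff)
  have dec: "(\<lambda>\<omega>. lam n \<omega> * (2 - lam n \<omega>) * (norm (d n \<omega>))\<^sup>2) = decrease n" for n
    by (simp add: decrease_def fun_eq_iff)
  show ?thesis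
    unfolding dec
  proof (intro conjI allI ballI impI; (elim conjE)?)
    fix n
    show "x n \<in> Lp_space M M 2 UNIV" by (rule x_in_L2)
  next
    fix n z assume "z \<in> Z"
    show "AE \<omega> in M. real_cond_exp M (\<X> n) (\<lambda>\<omega>. (norm (x (Suc n) \<omega> - z))\<^sup>2) \<omega>
          \<le> (norm (x n \<omega> - z))\<^sup>2 - real_cond_exp M (\<X> n) (decrease n) \<omega> + \<delta> n \<omega> z"
      by (rule cond_exp_dist_random_point[OF const_in_Lp[OF \<open>z \<in> Z\<close>]])
  next
    fix n z assume "z \<in> Lp_space M (\<X> n) 2 Z"
    then show "AE \<omega> in M. real_cond_exp M (\<X> n) (\<lambda>\<omega>. (norm (x (Suc n) \<omega> - z \<omega>))\<^sup>2) \<omega>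
          \<le> (norm (x n \<omega> - z \<omega>))\<^sup>2 - real_cond_exp M (\<X> n) (decrease n) \<omega> + \<delta> n \<omega> (z \<omega>)"
      by (rule cond_exp_dist_random_point)
  next
    fix n z assume "z \<in> Lp_space M (\<X> n) 2 Z"
    then show "(Lp_norm M 2 (\<lambda>\<omega>. x (Suc n) \<omega> - z \<omega>))\<^sup>2
          \<le> (Lp_norm M 2 (\<lambda>\<omega>. x n \<omega> - z \<omega>))\<^sup>2 - expectation (decrease n) + (\<integral>\<omega>. \<delta> n \<omega> (z \<omega>) \<partial>M)"
      unfolding Lp_norm_2_power2 by (rule expectation_dist_random_point)
  next
    assume "\<forall>z\<in>Z. AE \<omega> in M. summable (\<lambda>n. \<delta> n \<omega> z)"
    then show "AE \<omega> in M. Bseq (\<lambda>n. norm (x n \<omega>))" by (intro AE_Bseq_norm) blast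
  next
    fix z assume "\<forall>z\<in>Z. AE \<omega> in M. summable (\<lambda>n. \<delta> n \<omega> z)" "z \<in> M \<rightarrow>\<^sub>M restrict_space borel Z"
    then show "AE \<omega> in M. convergent (\<lambda>n. norm (x n \<omega> - z \<omega>))"
      using rv by (intro AE_convergent_norm_diff) blast+
  next
    assume "\<forall>z\<in>Z. AE \<omega> in M. summable (\<lambda>n. \<delta> n \<omega> z)"
    then show "AE \<omega> in M. summable (\<lambda>n. real_cond_exp M (\<X> n) (decrease n) \<omega>)"
      by (intro AE_summable_decrease) blast
  next
    assume "\<forall>z\<in>Z. AE \<omega> in M. summable (\<lambda>n. \<delta> n \<omega> z)" "AE \<omega> in M. weak_cluster_points (\<lambda>n. x n \<omega>) \<subseteq> Z"
    then show "\<exists>y \<in> M \<rightarrow>\<^sub>M restrict_space borel Z. AE \<omega> in M. weakly_converges (\<lambda>n. x n \<omega>) (y \<omega>)"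
      by (intro weak_convergence) blast+
  next
    assume "\<forall>z\<in>Z. AE \<omega> in M. summable (\<lambda>n. \<delta> n \<omega> z)" "AE \<omega> in M. strong_cluster_points (\<lambda>n. x n \<omega>) \<inter> Z \<noteq> {}"
    then show "\<exists>y \<in> M \<rightarrow>\<^sub>M restrict_space borel Z. AE \<omega> in M. (\<lambda>n. x n \<omega>) \<longlonglongrightarrow> y \<omega>"
      by (intro strong_convergence) blast+
  next
    assume "\<forall>z\<in>Z. AE \<omega> in M. summable (\<lambda>n. \<delta> n \<omega> z)"
      "AE \<omega> in M. strong_cluster_points (\<lambda>n. x n \<omega>) \<noteq> {}" "AE \<omega> in M. weak_cluster_points (\<lambda>n. x n \<omega>) \<subseteq> Z"
    then show "\<exists>y \<in> M \<rightarrow>\<^sub>M restrict_space borel Z. AE \<omega> in M. (\<lambda>n. x n \<omega>) \<longlonglongrightarrow> y \<omega>"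
      by (intro strong_convergence_of_cluster_point) blast+
  next
    assume "\<forall>z\<in>Z. summable (\<lambda>n. \<integral>\<omega>. \<delta> n \<omega> z \<partial>M)"
    then show "Bseq (\<lambda>n. Lp_norm M 2 (x n))" by (intro Bseq_L2_norm) blast
  next
    fix z assume "\<forall>z\<in>Z. summable (\<lambda>n. \<integral>\<omega>. \<delta> n \<omega> z \<partial>M)" "z \<in> Lp_space M M 2 Z"
    then show "convergent (\<lambda>n. Lp_norm M 1 (\<lambda>\<omega>. x n \<omega> - z \<omega>))" by (intro convergent_L1_norm_diff) blast+
  next
    assume "\<forall>z\<in>Z. summable (\<lambda>n. \<integral>\<omega>. \<delta> n \<omega> z \<partial>M)"
    then show "summable (\<lambda>n. expectation (decrease n))" by (intro summable_expectation_decrease) blast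
  next
    fix y :: "'w \<Rightarrow> 'h"
    assume *: "\<forall>z\<in>Z. summable (\<lambda>n. \<integral>\<omega>. \<delta> n \<omega> z \<partial>M)" "y \<in> borel_measurable M"
      "AE \<omega> in M. weakly_converges (\<lambda>n. x n \<omega>) (y \<omega>)"
    show "y \<in> Lp_space M M 2 UNIV" by (rule weak_L2_convergence(1)) (use * in blast)+
    show "weakly_converges_L2 M x y" by (rule weak_L2_convergence(2)) (use * in blast)+
  next
    fix y :: "'w \<Rightarrow> 'h"
    assume *: "\<forall>z\<in>Z. summable (\<lambda>n. \<integral>\<omega>. \<delta> n \<omega> z \<partial>M)" "y \<in> M \<rightarrow>\<^sub>M restrict_space borel Z"
    show "(AE \<omega> in M. (\<lambda>n. x n \<omega>) \<longlonglongrightarrow> y \<omega>) \<longleftrightarrow> Lp_converges M 1 x y"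
      by (rule strong_L1_convergence) (use * rv in blast)+
  next
    fix y :: "'w \<Rightarrow> 'h"
    assume *: "\<forall>z\<in>Z. summable (\<lambda>n. \<integral>\<omega>. \<delta> n \<omega> z \<partial>M)" "y \<in> M \<rightarrow>\<^sub>M restrict_space borel Z"
      "AE \<omega> in M. (\<lambda>n. x n \<omega>) \<longlonglongrightarrow> y \<omega>"
    have weak: "AE \<omega> in M. weakly_converges (\<lambda>n. x n \<omega>) (y \<omega>)"
      using *(3) by eventually_elim (rule tendsto_imp_weakly_converges)
    have "y \<in> Lp_space M M 2 UNIV" by (rule weak_L2_convergence(1)) (use * rv weak in blast)+
    then show "y \<in> Lp_space M M 2 Z" using rv[OF *(2)] by (simp add: Lp_space_2_iff)
    show "weakly_converges_L2 M x y" by (rule weak_L2_convergence(2)) (use * rv weak in blast)+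
  qed
qed

end
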